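(* Let $\mathsf{T}$ be the (local) moduli space of enhanced non-compact Calabi-Yau threefolds for the mirror family of local $\mathbb{F}_2$, with coordinates $(z_1,z_2,s_{22},s_{23},s_{43},s_{44})$. Let $\mathsf{R}_1,\mathsf{R}_2$ be the modular vector fields on $\mathsf{T}$, i.e. the vector fields satisfying $$\nabla_{\mathsf{R}_1}\omega_{\mathsf{t}}=\begin{pmatrix}0&Y_1^{-1}(\mathsf{t})&Y_2^{-1}(\mathsf{t})&0\\0&0&0&0\\0&0&0&1\\0&0&0&0\end{pmatrix}\omega_{\mathsf{t}},\qquad \nabla_{\mathsf{R}_2}\omega_{\mathsf{t}}=\begin{pmatrix}0&Y_3^{-1}(\mathsf{t})&Y_4^{-1}(\mathsf{t})&0\\0&0&0&1\\0&0&0&0\\0&0&0&0\end{pmatrix}\omega_{\mathsf{t}}$$ for some $Y_i(\mathsf{t})\in\mathcal{O}_{\mathsf{T}}$, and set $\partial_{\tau_i}f=df(\mathsf{R}_i)$ for $f\in\mathcal{O}_{\mathsf{T}}$, $i=1,2$. Then the differential ring $(\mathcal{O}_{\mathsf{T}},\partial_{\tau_1},\partial_{\tau_2})$ contains as a differential subring the ring $R_2$ of quasi-modular forms on $\Gamma_0(2)$, with the derivation $\partial_\tau$ of $R_2$ corresponding to $\partial_{\tau_1}$.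
   Context: **The family.** The mirror family of local $\mathbb{F}_2$ (the total space of $K_{\mathbb{F}_2}$) has fibres $X_z=\{uv+F_{\pmb a}(t_1,t_2)=0\}\subset\mathbb{C}^2\times(\mathbb{C}^* )^2$, $F_{\pmb a}=a_0+a_1t_1+a_2t_2+\frac{a_3}{t_1}+\frac{a_4}{t_1^2t_2}$, with torus-invariant moduli $z_1=\frac{a_1a_3}{a_0^2}$, $z_2=\frac{a_2a_4}{a_3^2}$. Put $\theta_i=z_i\frac{\partial}{\partial z_i}$. Let $\Omega=\mathrm{Res}\left[\frac{1}{F_{\pmb a}+uv}\frac{dt_1}{t_1}\wedge\frac{dt_2}{t_2}\wedge du\wedge dv\right]$. The bundle with fibre $H^3(X_z,\mathbb{C})$ (rank 4) has frame $\Omega,\nabla_{\theta_1-2\theta_2}\Omega,\nabla_{\theta_1}\Omega,\nabla_{\theta_1}^2\Omega$, where $\nabla$ is the flat Gauss-Manin connection, which is determined by the Picard-Fuchs system $\mathcal{L}_1\Omega=\mathcal{L}_2\Omega=0$ (with $\theta_i$ acting as $\nabla_{\theta_i}$), $$\mathcal{L}_1=\theta_1(\theta_1-2\theta_2)-2z_1(2\theta_1+1)\theta_1,\qquad \mathcal{L}_2=\theta_2^2-z_2(\theta_1-2\theta_2-1)(\theta_1-2\theta_2).$$ The mixed Hodge structure is: $F^3=\langle\Omega\rangle$, $F^2=\langle\Omega,\nabla_{\theta_1-2\theta_2}\Omega,\nabla_{\theta_1}\Omega\rangle$, $F^1=F^0=H^3$; $W_2=0$, $W_3=\langle\nabla_{\theta_1}\Omega,\nabla_{\theta_1}^2\Omega\rangle$,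 $W_4=W_5=W_3\oplus\langle\nabla_{\theta_1-2\theta_2}\Omega\rangle$, $W_6=H^3$. The polarization pairing is skew-symmetric with only non-zero entries coming from $\langle\nabla_{\theta_1}^2\Omega,\nabla_{\theta_1}\Omega\rangle=Y_{111}=\frac{1}{(1-4z_1)^2-64z_1^2z_2}$. Fix the frame $\omega=(\Omega,\nabla_{\theta_1-2\theta_2}\Omega,\nabla_{\theta_1}\Omega,Y_{111}^{-1}\nabla_{\theta_1}^2\Omega)^{\rm tr}$ and write $\nabla\omega=A_{GM}\,\omega$ with $A_{GM}$ a matrix of 1-forms in $z_1,z_2$. **Enhanced varieties and $\mathsf{T}$.** An enhanced variety is a pair $(X_z,\omega')$ with $\omega'$ an ordered basis of $H^3(X_z,\mathbb{C})$ such that the first $\dim F^k$ elements span $F^k$, the last $\dim W_k$ elements span $W_k$, and the pairing on $\mathrm{Gr}^W_3$ is $\Phi_3=\begin{pmatrix}0&-1\\1&0\end{pmatrix}$ (and is $(0)$ on $\mathrm{Gr}^W_4$, $\mathrm{Gr}^W_6$). Normalizing the first entry to $1$, all such bases are $\omega_{\mathsf{t}}=S\omega$ with $$S=\begin{pmatrix}1&0&0&0\\0&s_{22}&s_{23}&0\\0&0&s_{44}^{-1}&0\\0&0&s_{43}&s_{44}\end{pmatrix}.$$ The moduli space is taken locally: $\mathsf{T}=V_0\times U_0$, with $V_0$ an (analytic) open set in the $(z_1,z_2)$-space and $U_0$ an (analytic) neighbourhood of $S=\mathrm{Id}$ in the space of matrices $S$; $\mathcal{O}_{\mathsf{T}}$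 denotes its ring of regular functions. The Gauss-Manin connection on $\mathsf{T}$ is $\nabla\omega_{\mathsf{t}}=(dS+SA_{GM})S^{-1}\omega_{\mathsf{t}}$. **The ring $R_2$.** The differential ring of quasi-modular forms on $\Gamma_0(2)$ is $$R_2=\mathbb{C}[\alpha,A,B,C,E]/(B^4-(1-\alpha)A^4,\;C^4-\alpha A^4)$$ with the derivation $\partial_\tau$ given by $$\partial_\tau\alpha=\alpha(1-\alpha)A^2,\quad \partial_\tau A=\tfrac18A\left(E+\tfrac{C^4-B^4}{A^2}\right)=\tfrac18A\left(E+(2\alpha-1)A^2\right),$$ $$\partial_\tau B=\tfrac18B(E-A^2),\quad \partial_\tau C=\tfrac18C(E+A^2),\quad \partial_\tau E=\tfrac18(E^2-A^4).$$ (Here $A=\frac{(64\eta(2\tau)^{24}+\eta(\tau)^{24})^{1/4}}{\eta(\tau)^2\eta(2\tau)^2}$, $B=\frac{\eta(\tau)^4}{\eta(2\tau)^2}$, $C=2^{3/2}\frac{\eta(2\tau)^4}{\eta(\tau)^2}$, $\alpha=C^4/A^4$, $E=\partial_\tau\log(B^4C^4)$, $\partial_\tau=\frac{1}{2\pi i}\frac{\partial}{\partial\tau}$, $\eta$ the Dedekind eta function.) *)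

theory Defs
  imports
    "HOL-Analysis.Analysis"
    "HOL-Library.Poly_Mapping"
    "HOL-Algebra.QuotRing"
begin

section \<open>Holomorphic functions of several complex variables\<close>

text \<open>Existence of a complex-linear derivative at every point; only used for open \<open>S\<close>.\<close>

definition holo_on :: "(complex^'n \<Rightarrow> complex) \<Rightarrow> (complex^'n) set \<Rightarrow> bool" where
  "holo_on f S \<longleftrightarrow>
     (\<forall>x\<in>S. \<exists>f'. (f has_derivative f') (at x) \<and> Vector_Spaces.linear (*s) (*) f')"


section \<open>The Gauss--Manin connection of the mirror family of local \<open>\<bbbF>\<^sub>2\<close>\<close>

text \<open>The inverse of the Yukawa coupling \<open>Y\<^sub>1\<^sub>1\<^sub>1\<close>; it vanishes on the discriminant.\<close>

definition Yinv :: "complex^2 \<Rightarrow> complex" where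
  "Yinv z = (1 - 4 * z$1)^2 - 64 * (z$1)^2 * z$2"

text \<open>
  Off this locus the family degenerates, the logarithmic fields \<open>\<theta>\<^sub>1, \<theta>\<^sub>2\<close> do not span the tangent
  space, or (for \<open>z\<^sub>2 = 1/4\<close>, where \<open>\<L>\<^sub>2\<close> yields a linear relation) the four chosen sections are
  not a frame.
\<close>

definition regular_locus :: "(complex^2) set" where
  "regular_locus = {z. z$1 \<noteq> 0 \<and> z$2 \<noteq> 0 \<and> 1 - 4 * z$2 \<noteq> 0 \<and> Yinv z \<noteq> 0}"

text \<open>
  A section \<open>\<Sum>\<^sub>i f\<^sub>i \<omega>\<^sub>i\<close> of the rank 4 bundle is represented by its row vector \<open>f\<close> of coefficients in
  the frame \<open>\<omega>\<close>. A matrix of 1-forms is a function \<open>A\<close>, where \<open>A z v\<close> is the value at the point \<open>z\<close>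
  on the tangent vector \<open>v\<close>. Then \<open>\<nabla>\<omega> = A\<omega>\<close> reads \<open>\<nabla>\<^sub>X f = df(X) + f A(X)\<close>.
\<close>

type_synonym sect = "complex^2 \<Rightarrow> complex^4"
type_synonym conn_form = "complex^2 \<Rightarrow> complex^2 \<Rightarrow> complex^4^4"

definition cov_deriv :: "conn_form \<Rightarrow> (complex^2 \<Rightarrow> complex^2) \<Rightarrow> sect \<Rightarrow> sect" where
  "cov_deriv A X f = (\<lambda>z. frechet_derivative f (at z) (X z) + f z v* A z (X z))"

definition theta :: "2 \<Rightarrow> complex^2 \<Rightarrow> complex^2" where
  "theta i z = axis i (z$i)"

definition nab :: "conn_form \<Rightarrow> 2 \<Rightarrow> sect \<Rightarrow> sect" where
  "nab A i = cov_deriv A (theta i)"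

text \<open>The action of \<open>\<theta>\<^sub>1 - 2\<theta>\<^sub>2\<close>.\<close>

definition nab12 :: "conn_form \<Rightarrow> sect \<Rightarrow> sect" where
  "nab12 A f = (\<lambda>z. nab A 1 f z - 2 *s nab A 2 f z)"

definition PF1 :: "conn_form \<Rightarrow> sect \<Rightarrow> sect" where
  "PF1 A f = (\<lambda>z. nab A 1 (nab12 A f) z
     - (2 * z$1) *s (2 *s nab A 1 (nab A 1 f) z + nab A 1 f z))"

definition PF2 :: "conn_form \<Rightarrow> sect \<Rightarrow> sect" where
  "PF2 A f = (\<lambda>z. nab A 2 (nab A 2 f) z
     - (z$2) *s (nab12 A (nab12 A f) z - nab12 A f z))"

definition Omega :: sect where
  "Omega = (\<lambda>z. axis 1 1)"

text \<open>
  \<open>A\<close> is the matrix \<open>A\<^sub>G\<^sub>M\<close> over the open set \<open>V\<close>: a holomorphic flat connection satisfying the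
  Picard--Fuchs system, written in the frame
  \<open>(\<Omega>, \<nabla>\<^bsub>\<theta>\<^sub>1-2\<theta>\<^sub>2\<^esub>\<Omega>, \<nabla>\<^bsub>\<theta>\<^sub>1\<^esub>\<Omega>, Y\<^sub>1\<^sub>1\<^sub>1\<^sup>-\<^sup>1 \<nabla>\<^bsub>\<theta>\<^sub>1\<^esub>\<nabla>\<^bsub>\<theta>\<^sub>1\<^esub>\<Omega>)\<close>. Flatness is stated for the
  commuting fields \<open>\<theta>\<^sub>1, \<theta>\<^sub>2\<close>, which span the tangent spaces. These conditions determine \<open>A\<close> on \<open>V\<close>.
\<close>

definition gauss_manin :: "(complex^2) set \<Rightarrow> conn_form \<Rightarrow> bool" where
  "gauss_manin V A \<longleftrightarrow>
     (\<forall>z\<in>V. \<forall>i j. Vector_Spaces.linear (*s) (*) (\<lambda>v. A z v $ i $ j)) \<and>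
     (\<forall>v i j. holo_on (\<lambda>z. A z v $ i $ j) V) \<and>
     (\<forall>f. (\<forall>i. holo_on (\<lambda>z. f z $ i) V) \<longrightarrow>
        (\<forall>z\<in>V. nab A 1 (nab A 2 f) z = nab A 2 (nab A 1 f) z)) \<and>
     (\<forall>z\<in>V. PF1 A Omega z = 0 \<and> PF2 A Omega z = 0) \<and>
     (\<forall>z\<in>V. nab12 A Omega z = axis 2 1 \<and>
            nab A 1 Omega z = axis 3 1 \<and>
            Yinv z *s nab A 1 (nab A 1 Omega) z = axis 4 1)"


section \<open>Enhanced varieties\<close>

text \<open>The mixed Hodge structure and the polarization in coordinates with respect to \<open>\<omega>\<close>.\<close>

definition hodge_F :: "nat \<Rightarrow> (complex^4) set" where
  "hodge_F k =
     (if k \<le> 1 then UNIV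
      else if k = 2 then vec.span {axis 1 1, axis 2 1, axis 3 1}
      else if k = 3 then vec.span {axis 1 1}
      else {0})"

definition weight_W :: "nat \<Rightarrow> (complex^4) set" where
  "weight_W k =
     (if k \<le> 2 then {0}
      else if k = 3 then vec.span {axis 3 1, axis 4 1}
      else if k \<le> 5 then vec.span {axis 2 1, axis 3 1, axis 4 1}
      else UNIV)"

text \<open>
  The only non-zero entries come from
  \<open>\<langle>\<omega>\<^sub>4, \<omega>\<^sub>3\<rangle> = Y\<^sub>1\<^sub>1\<^sub>1\<^sup>-\<^sup>1 \<langle>\<nabla>\<^bsub>\<theta>\<^sub>1\<^esub>\<nabla>\<^bsub>\<theta>\<^sub>1\<^esub>\<Omega>, \<nabla>\<^bsub>\<theta>\<^sub>1\<^esub>\<Omega>\<rangle> = 1\<close>.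
\<close>

definition pairing :: "complex^4 \<Rightarrow> complex^4 \<Rightarrow> complex" where
  "pairing x y = x$4 * y$3 - x$3 * y$4"

text \<open>
  The rows of \<open>S\<close> are the members of the basis \<open>S\<omega>\<close>. The last two, the second and the first of them
  represent bases of \<open>Gr\<^sub>3\<close>, \<open>Gr\<^sub>4\<close> and \<open>Gr\<^sub>6\<close> of the weight filtration.
\<close>

definition enhanced :: "complex^4^4 \<Rightarrow> bool" where
  "enhanced S \<longleftrightarrow>
     invertible S \<and>
     (let b = [S$1, S$2, S$3, S$4] in
       (\<forall>k. vec.span (set (take (vec.dim (hodge_F k)) b)) = hodge_F k) \<and>
       (\<forall>k. vec.span (set (drop (4 - vec.dim (weight_W k)) b)) = weight_W k)) \<and>
     pairing (S$3) (S$3) = 0 \<and> pairing (S$3) (S$4) = -1 \<and>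
     pairing (S$4) (S$3) = 1 \<and> pairing (S$4) (S$4) = 0 \<and>
     pairing (S$2) (S$2) = 0 \<and> pairing (S$1) (S$1) = 0"

text \<open>The components of \<open>s\<close> are \<open>s\<^sub>2\<^sub>2, s\<^sub>2\<^sub>3, s\<^sub>4\<^sub>3, s\<^sub>4\<^sub>4\<close> in this order.\<close>

definition enh_mat :: "complex^4 \<Rightarrow> complex^4^4" where
  "enh_mat s = vector
     [vector [1, 0, 0, 0],
      vector [0, s$1, s$2, 0],
      vector [0, 0, inverse (s$4), 0],
      vector [0, 0, s$3, s$4]]"

lemma vector_4:
  "(vector [a, b, c, d] :: 'a::zero^4) $ 1 = a"
  "(vector [a, b, c, d] :: 'a::zero^4) $ 2 = b"
  "(vector [a, b, c, d] :: 'a::zero^4) $ 3 = c"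
  "(vector [a, b, c, d] :: 'a::zero^4) $ 4 = d"
  unfolding vector_def by simp_all

lemma vec_eq_4: "(x::'a^4) = y \<longleftrightarrow> x$1 = y$1 \<and> x$2 = y$2 \<and> x$3 = y$3 \<and> x$4 = y$4"
  by (auto simp: vec_eq_iff forall_4)

lemma span_axes:
  "vec.span {axis 1 1 :: complex^4} = {x. x$2 = 0 \<and> x$3 = 0 \<and> x$4 = 0}"
  "vec.span {axis 1 1, axis 2 1, axis 3 1 :: complex^4} = {x. x$4 = 0}"
  "vec.span {axis 3 1, axis 4 1 :: complex^4} = {x. x$1 = 0 \<and> x$2 = 0}"
  "vec.span {axis 2 1, axis 3 1, axis 4 1 :: complex^4} = {x. x$1 = 0}"
  by (auto simp: vec.span_insert vec_eq_4 axis_def)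

lemma dim_axes:
  "vec.dim {axis 1 1 :: complex^4} = 1"
  "vec.dim {axis 1 1, axis 2 1, axis 3 1 :: complex^4} = 3"
  "vec.dim {axis 3 1, axis 4 1 :: complex^4} = 2"
  "vec.dim {axis 2 1, axis 3 1, axis 4 1 :: complex^4} = 3"
proof -
  have card: "vec.dim B = card B" if "B \<subseteq> cart_basis" for B :: "(complex^4) set"
    using that vec.independent_Basis vec.independent_mono vec.dim_eq_card_independent by blast
  have mem: "axis i (1::complex) \<in> cart_basis" for i :: 4
    by (auto simp: cart_basis_def)
  have ne: "axis i (1::complex) = axis j 1 \<longleftrightarrow> i = j" for i j :: 4
    by (auto simp: axis_eq_axis)
  show "vec.dim {axis 1 1 :: complex^4} = 1"
    "vec.dim {axis 1 1, axis 2 1, axis 3 1 :: complex^4} = 3"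
    "vec.dim {axis 3 1, axis 4 1 :: complex^4} = 2"
    "vec.dim {axis 2 1, axis 3 1, axis 4 1 :: complex^4} = 3"
    by (subst card; simp add: mem ne)+
qed

lemma forall_hodge_F:
  "(\<forall>k. P (vec.dim (hodge_F k)) (hodge_F k)) \<longleftrightarrow>
     P 4 UNIV \<and> P 3 {x. x$4 = 0} \<and> P 1 {x. x$2 = 0 \<and> x$3 = 0 \<and> x$4 = 0} \<and> P 0 {0}" (is "?L \<longleftrightarrow> ?R")
proof
  assume L: ?L
  show ?R using L[rule_format, of 1] L[rule_format, of 2] L[rule_format, of 3] L[rule_format, of 4]
    by (auto simp: hodge_F_def dim_axes vec_dim_card simp del: vec.dim_UNIV simp flip: span_axes)
next
  assume ?R
  then show ?L
    by (simp add: hodge_F_def dim_axes vec_dim_card del: vec.dim_UNIV flip: span_axes)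
qed

lemma forall_weight_W:
  "(\<forall>k. P (vec.dim (weight_W k)) (weight_W k)) \<longleftrightarrow>
     P 0 {0} \<and> P 2 {x. x$1 = 0 \<and> x$2 = 0} \<and> P 3 {x. x$1 = 0} \<and> P 4 UNIV" (is "?L \<longleftrightarrow> ?R")
proof
  assume L: ?L
  show ?R using L[rule_format, of 1] L[rule_format, of 3] L[rule_format, of 4] L[rule_format, of 6]
    by (auto simp: weight_W_def dim_axes vec_dim_card simp del: vec.dim_UNIV simp flip: span_axes)
next
  assume ?R
  then show ?L
    by (simp add: weight_W_def dim_axes vec_dim_card del: vec.dim_UNIV flip: span_axes)
qed

lemma enhanced_alt:
  "enhanced S \<longleftrightarrow> invertible S \<and>
     vec.span {S$1, S$2, S$3, S$4} = UNIV \<and>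
     vec.span {S$1, S$2, S$3} = {x. x$4 = 0} \<and>
     vec.span {S$1} = {x. x$2 = 0 \<and> x$3 = 0 \<and> x$4 = 0} \<and>
     vec.span {S$3, S$4} = {x. x$1 = 0 \<and> x$2 = 0} \<and>
     vec.span {S$2, S$3, S$4} = {x. x$1 = 0} \<and>
     pairing (S$3) (S$4) = -1"
proof -
  have nums: "take 4 [S$1, S$2, S$3, S$4] = [S$1, S$2, S$3, S$4]"
    "take 3 [S$1, S$2, S$3, S$4] = [S$1, S$2, S$3]"
    "take 1 [S$1, S$2, S$3, S$4] = [S$1]"
    "drop 2 [S$1, S$2, S$3, S$4] = [S$3, S$4]"
    "drop 1 [S$1, S$2, S$3, S$4] = [S$2, S$3, S$4]"
    "(4::nat) - 2 = 2" "(4::nat) - 3 = 1"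
    by (simp_all add: numeral_eq_Suc)
  have skew: "pairing x y = - pairing y x" "pairing x x = 0" for x y
    by (simp_all add: pairing_def)
  show ?thesis
    unfolding enhanced_def Let_def
      forall_hodge_F[of "\<lambda>n F. vec.span (set (take n [S$1, S$2, S$3, S$4])) = F"]
      forall_weight_W[of "\<lambda>n F. vec.span (set (drop (4 - n) [S$1, S$2, S$3, S$4])) = F"]
      nums
    using skew(1)[of "S$3" "S$4"] by (auto simp: skew(2))
qed

text \<open>All enhanced bases whose first member has \<open>\<Omega>\<close>-coefficient 1 are of the form \<open>S\<omega>\<close>.\<close>

theorem enhanced_iff_enh_mat:
  "enhanced S \<and> S$1$1 = 1 \<longleftrightarrow> (\<exists>s. s$1 \<noteq> 0 \<and> s$4 \<noteq> 0 \<and> S = enh_mat s)"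
proof
  assume "enhanced S \<and> S$1$1 = 1"
  then have sp: "vec.span {S$1, S$2, S$3} = {x. x$4 = 0}"
     "vec.span {S$1} = {x. x$2 = 0 \<and> x$3 = 0 \<and> x$4 = 0}"
     "vec.span {S$3, S$4} = {x. x$1 = 0 \<and> x$2 = 0}"
     "vec.span {S$2, S$3, S$4} = {x. x$1 = 0}"
    and p: "pairing (S$3) (S$4) = -1" and one: "S$1$1 = 1"
    unfolding enhanced_alt by blast+
  have 1: "S$1$2 = 0" "S$1$3 = 0" "S$1$4 = 0"
    using sp(2) vec.span_base[of "S$1" "{S$1}"] by auto
  have 2: "S$2$4 = 0" "S$2$1 = 0"
    using sp(1,4) vec.span_base[of "S$2" "{S$1, S$2, S$3}"]
      vec.span_base[of "S$2" "{S$2, S$3, S$4}"] by auto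
  have 3: "S$3$4 = 0" "S$3$1 = 0" "S$3$2 = 0"
    using sp(1,3) vec.span_base[of "S$3" "{S$1, S$2, S$3}"]
      vec.span_base[of "S$3" "{S$3, S$4}"] by auto
  have 4: "S$4$1 = 0" "S$4$2 = 0"
    using sp(3) vec.span_base[of "S$4" "{S$3, S$4}"] by auto
  have 5: "S$3$3 * S$4$4 = 1"
    using p 3 by (simp add: pairing_def)
  have 6: "S$2$2 \<noteq> 0"
  proof
    assume "S$2$2 = 0"
    then have "vec.span {S$2, S$3, S$4} \<subseteq> {x. x$2 = 0}"
      using 3 4 by (intro vec.span_minimal) (auto simp: vec.subspace_def)
    moreover have "axis 2 1 \<in> vec.span {S$2, S$3, S$4}"
      unfolding sp(4) by (simp add: axis_def)
    ultimately show False by (auto simp: axis_def)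
  qed
  have 7: "S$4$4 \<noteq> 0" using 5 by auto
  show "\<exists>s. s$1 \<noteq> 0 \<and> s$4 \<noteq> 0 \<and> S = enh_mat s"
    using 1 2 3 4 5 6 7 one
    by (intro exI[of _ "vector [S$2$2, S$2$3, S$4$3, S$4$4]"])
      (auto simp: enh_mat_def vector_4 vec_eq_4 inverse_eq_divide field_simps)
next
  assume "\<exists>s. s$1 \<noteq> 0 \<and> s$4 \<noteq> 0 \<and> S = enh_mat s"
  then obtain s where s: "s$1 \<noteq> 0" "s$4 \<noteq> 0" and S: "S = enh_mat s" by blast
  let ?a = "s$1" and ?b = "s$2" and ?c = "s$3" and ?d = "s$4"
  have rows: "S$1 = vector [1, 0, 0, 0]" "S$2 = vector [0, ?a, ?b, 0]"
    "S$3 = vector [0, 0, inverse ?d, 0]" "S$4 = vector [0, 0, ?c, ?d]"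
    by (simp_all add: S enh_mat_def vector_4)
  let ?T = "vector [vector [1, 0, 0, 0], vector [0, inverse ?a, - ?b * ?d / ?a, 0],
     vector [0, 0, ?d, 0], vector [0, 0, - ?c, inverse ?d]] :: complex^4^4"
  have "S ** ?T = mat 1" "?T ** S = mat 1"
    using s unfolding S enh_mat_def
    by (simp_all add: matrix_matrix_mult_def mat_def vec_eq_4 sum_4 vector_4 field_simps)
  then have "invertible S" unfolding invertible_def by blast
  moreover have "vec.span {S$1} = {x. x$2 = 0 \<and> x$3 = 0 \<and> x$4 = 0}"
    by (auto simp: rows vec.span_insert vec_eq_4 vector_4)
  moreover have "vec.span {S$1, S$2, S$3} = {x. x$4 = 0}"
  proof -
    have "x \<in> vec.span {S$1, S$2, S$3}" if "x$4 = 0" for x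
    proof -
      have "x = x$1 *s S$1 + (x$2 / ?a) *s S$2 + ((x$3 - x$2 / ?a * ?b) * ?d) *s S$3"
        using that s by (simp add: rows vec_eq_4 vector_4 field_simps)
      then show ?thesis
        by (metis insertI1 insertI2 vec.span_add vec.span_base vec.span_scale)
    qed
    moreover have "vec.span {S$1, S$2, S$3} \<subseteq> {x. x$4 = 0}"
      by (intro vec.span_minimal) (auto simp: vec.subspace_def rows vector_4)
    ultimately show ?thesis by blast
  qed
  moreover have span34: "x \<in> vec.span {S$3, S$4}" if "x$1 = 0" "x$2 = 0" for x
  proof -
    have "x = ((x$3 - x$4 / ?d * ?c) * ?d) *s S$3 + (x$4 / ?d) *s S$4"
      using that s by (simp add: rows vec_eq_4 vector_4 field_simps)
    then show ?thesis
      by (metis insertI1 insertI2 vec.span_add vec.span_base vec.span_scale)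
  qed
  moreover have "vec.span {S$3, S$4} \<subseteq> {x. x$1 = 0 \<and> x$2 = 0}"
    by (intro vec.span_minimal) (auto simp: vec.subspace_def rows vector_4)
  moreover have span234: "x \<in> vec.span {S$2, S$3, S$4}" if "x$1 = 0" for x
  proof -
    have "x - (x$2 / ?a) *s S$2 \<in> vec.span {S$3, S$4}"
      using that s by (intro span34) (simp_all add: rows vector_4)
    then show ?thesis by (auto simp: vec.span_insert)
  qed
  moreover have "vec.span {S$2, S$3, S$4} \<subseteq> {x. x$1 = 0}"
    by (intro vec.span_minimal) (auto simp: vec.subspace_def rows vector_4)
  moreover have "x \<in> vec.span {S$1, S$2, S$3, S$4}" for x
  proof -
    have "x - x$1 *s S$1 \<in> vec.span {S$2, S$3, S$4}"
      by (intro span234) (simp add: rows vector_4)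
    then show ?thesis by (metis (mono_tags, lifting) mem_Collect_eq vec.span_insert)
  qed
  moreover have "pairing (S$3) (S$4) = -1" "S$1$1 = 1"
    using s by (simp_all add: rows pairing_def vector_4)
  ultimately show "enhanced S \<and> S$1$1 = 1"
    unfolding enhanced_alt by blast
qed


section \<open>The moduli space \<open>T\<close> and its functions and vector fields\<close>

text \<open>
  The ambient space is \<open>\<complex>\<^sup>2 \<times> \<complex>\<^sup>4\<close> with the index type \<open>2 + 4\<close>, so that \<open>holo_on\<close> and \<open>*s\<close> apply.
\<close>

type_synonym point = "complex^(2 + 4)"

definition zpart :: "point \<Rightarrow> complex^2" where
  "zpart t = (\<chi> i. t $ Inl i)"

definition spart :: "point \<Rightarrow> complex^4" where
  "spart t = (\<chi> i. t $ Inr i)"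

text \<open>
  Only local charts \<open>V \<times> U\<close> are considered: \<open>V\<close> will be simply connected, so that
  \<open>B\<^sup>4 = 4 Y\<^sub>1\<^sub>1\<^sub>1\<^sup>-\<^sup>1 s\<^sub>4\<^sub>4\<^sup>4\<close>, \<open>C\<^sup>4 = 256 z\<^sub>1\<^sup>2 z\<^sub>2 s\<^sub>4\<^sub>4\<^sup>4\<close> and \<open>A\<^sup>2 = 2 (1 - 4 z\<^sub>1) s\<^sub>4\<^sub>4\<^sup>2\<close> have
  single-valued roots, and disjoint from \<open>1 - 4 z\<^sub>1 = 0\<close>, where \<open>A\<close> vanishes and
  \<open>\<alpha> = C\<^sup>4 / A\<^sup>4 = 64 z\<^sub>1\<^sup>2 z\<^sub>2 / (1 - 4 z\<^sub>1)\<^sup>2\<close> has its pole.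
\<close>

definition moduli :: "(complex^2) set \<Rightarrow> (complex^4) set \<Rightarrow> point set" where
  "moduli V U = {t. zpart t \<in> V \<and> spart t \<in> U}"

text \<open>
  Functions on \<open>T\<close> are made canonical by the value \<open>undefined\<close> outside \<open>T\<close>.
\<close>

definition O_ring :: "point set \<Rightarrow> (point \<Rightarrow> complex) ring" where
  "O_ring T =
     \<lparr>carrier = {f \<in> extensional T. holo_on f T},
      monoid.mult = (\<lambda>f g. \<lambda>t\<in>T. f t * g t),
      one = (\<lambda>t\<in>T. 1),
      zero = (\<lambda>t\<in>T. 0),
      add = (\<lambda>f g. \<lambda>t\<in>T. f t + g t)\<rparr>"

definition vector_field :: "point set \<Rightarrow> (point \<Rightarrow> point) \<Rightarrow> bool" where
  "vector_field T R \<longleftrightarrow> (\<forall>i. holo_on (\<lambda>t. R t $ i) T)"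

text \<open>\<open>\<partial>f = df(R)\<close>\<close>

definition lie :: "point set \<Rightarrow> (point \<Rightarrow> point) \<Rightarrow> (point \<Rightarrow> complex) \<Rightarrow> point \<Rightarrow> complex" where
  "lie T R f = (\<lambda>t\<in>T. frechet_derivative f (at t) (R t))"

text \<open>
  The matrix of \<open>\<nabla>\<^sub>R\<close> in the frame \<open>\<omega>\<^sub>t\<close>, i.e. \<open>(dS + S A\<^sub>G\<^sub>M) S\<^sup>-\<^sup>1\<close> evaluated on \<open>R\<close>, where \<open>A\<^sub>G\<^sub>M\<close> is
  pulled back along the projection to the \<open>z\<close>-space.
\<close>

definition gm_matrix :: "conn_form \<Rightarrow> (point \<Rightarrow> point) \<Rightarrow> point \<Rightarrow> complex^4^4" where
  "gm_matrix A R t =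
     (frechet_derivative (\<lambda>u. enh_mat (spart u)) (at t) (R t)
        + enh_mat (spart t) ** A (zpart t) (zpart (R t)))
     ** matrix_inv (enh_mat (spart t))"

definition modular_field1 :: "point set \<Rightarrow> conn_form \<Rightarrow> (point \<Rightarrow> point) \<Rightarrow> bool" where
  "modular_field1 T A R \<longleftrightarrow> vector_field T R \<and>
     (\<exists>Y1\<in>carrier (O_ring T). \<exists>Y2\<in>carrier (O_ring T). \<forall>t\<in>T.
        Y1 t \<noteq> 0 \<and> Y2 t \<noteq> 0 \<and>
        gm_matrix A R t = vector
          [vector [0, inverse (Y1 t), inverse (Y2 t), 0],
           vector [0, 0, 0, 0],
           vector [0, 0, 0, 1],
           vector [0, 0, 0, 0]])"

definition modular_field2 :: "point set \<Rightarrow> conn_form \<Rightarrow> (point \<Rightarrow> point) \<Rightarrow> bool" where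
  "modular_field2 T A R \<longleftrightarrow> vector_field T R \<and>
     (\<exists>Y3\<in>carrier (O_ring T). \<exists>Y4\<in>carrier (O_ring T). \<forall>t\<in>T.
        Y3 t \<noteq> 0 \<and> Y4 t \<noteq> 0 \<and>
        gm_matrix A R t = vector
          [vector [0, inverse (Y3 t), inverse (Y4 t), 0],
           vector [0, 0, 0, 1],
           vector [0, 0, 0, 0],
           vector [0, 0, 0, 0]])"


section \<open>The differential ring \<open>R\<^sub>2\<close> of quasi-modular forms on \<open>\<Gamma>\<^sub>0(2)\<close>\<close>

datatype gen = Gen_alpha | Gen_A | Gen_B | Gen_C | Gen_E

text \<open>\<open>\<complex>[\<alpha>, A, B, C, E]\<close>; a monomial is its exponent vector of type \<open>gen \<Rightarrow>\<^sub>0 nat\<close>.\<close>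

type_synonym pol = "(gen \<Rightarrow>\<^sub>0 nat) \<Rightarrow>\<^sub>0 complex"

definition Var :: "gen \<Rightarrow> pol" where
  "Var v = Poly_Mapping.single (Poly_Mapping.single v 1) 1"

definition Const :: "complex \<Rightarrow> pol" where
  "Const c = Poly_Mapping.single 0 c"

definition pol_ring :: "pol ring" where
  "pol_ring =
     \<lparr>carrier = UNIV, monoid.mult = (*), one = 1, zero = 0, add = (+)\<rparr>"

text \<open>The \<open>\<complex>\<close>-linear derivation with prescribed values \<open>d v\<close> on the generators \<open>v\<close>.\<close>

definition derivation :: "(gen \<Rightarrow> pol) \<Rightarrow> pol \<Rightarrow> pol" where
  "derivation d p =
     (\<Sum>m\<in>Poly_Mapping.keys p. \<Sum>v\<in>Poly_Mapping.keys m.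
        Poly_Mapping.single (m - Poly_Mapping.single v 1)
          (of_nat (Poly_Mapping.lookup m v) * Poly_Mapping.lookup p m) * d v)"

fun dtau_gen :: "gen \<Rightarrow> pol" where
  "dtau_gen Gen_alpha = Var Gen_alpha * (1 - Var Gen_alpha) * Var Gen_A ^ 2"
| "dtau_gen Gen_A =
     Const (1/8) * Var Gen_A * (Var Gen_E + (2 * Var Gen_alpha - 1) * Var Gen_A ^ 2)"
| "dtau_gen Gen_B = Const (1/8) * Var Gen_B * (Var Gen_E - Var Gen_A ^ 2)"
| "dtau_gen Gen_C = Const (1/8) * Var Gen_C * (Var Gen_E + Var Gen_A ^ 2)"
| "dtau_gen Gen_E = Const (1/8) * (Var Gen_E ^ 2 - Var Gen_A ^ 4)"

definition rel1 :: pol where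
  "rel1 = Var Gen_B ^ 4 - (1 - Var Gen_alpha) * Var Gen_A ^ 4"

definition rel2 :: pol where
  "rel2 = Var Gen_C ^ 4 - Var Gen_alpha * Var Gen_A ^ 4"

definition QM_ideal :: "pol set" where
  "QM_ideal = genideal pol_ring {rel1, rel2}"

definition QM_ring :: "pol set ring" where
  "QM_ring = pol_ring Quot QM_ideal"

definition QM_class :: "pol \<Rightarrow> pol set" where
  "QM_class p = QM_ideal +>\<^bsub>pol_ring\<^esub> p"

text \<open>
  The induced derivation on residue classes; \<open>QM_dtau_class\<close> below shows that it is well defined.
\<close>

definition QM_dtau :: "pol set \<Rightarrow> pol set" where
  "QM_dtau X = (\<Union>p\<in>X. QM_class (derivation dtau_gen p))"

lemma pol_ring_simps [simp]:
  "carrier pol_ring = UNIV" "mult pol_ring = (*)" "one pol_ring = 1"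
  "zero pol_ring = 0" "add pol_ring = (+)"
  by (simp_all add: pol_ring_def)

lemma cring_pol_ring: "cring pol_ring"
proof (intro cringI abelian_groupI comm_monoidI)
  fix x :: pol
  show "\<exists>y\<in>carrier pol_ring. y \<oplus>\<^bsub>pol_ring\<^esub> x = \<zero>\<^bsub>pol_ring\<^esub>"
    by (intro bexI[of _ "- x"]) auto
qed (auto simp: algebra_simps)

lemma derivation_superset:
  assumes "finite M" "Poly_Mapping.keys p \<subseteq> M"
  shows "derivation d p = (\<Sum>m\<in>M. \<Sum>v\<in>Poly_Mapping.keys m.
     Poly_Mapping.single (m - Poly_Mapping.single v 1)
       (of_nat (Poly_Mapping.lookup m v) * Poly_Mapping.lookup p m) * d v)"
  unfolding derivation_def using assms
  by (intro sum.mono_neutral_left) (auto simp: in_keys_iff)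

lemma derivation_add: "derivation d (p + q) = derivation d p + derivation d q"
proof -
  let ?M = "Poly_Mapping.keys p \<union> Poly_Mapping.keys q"
  have "Poly_Mapping.keys (p + q) \<subseteq> ?M" by (rule Poly_Mapping.keys_add)
  then show ?thesis
    by (simp add: derivation_superset[of ?M] lookup_add distrib_left single_add distrib_right
        sum.distrib)
qed

lemma derivation_zero: "derivation d 0 = 0"
  by (simp add: derivation_def)

lemma derivation_sum: "derivation d (sum f I) = (\<Sum>i\<in>I. derivation d (f i))"
  by (induction I rule: infinite_finite_induct) (auto simp: derivation_zero derivation_add)

lemma derivation_uminus: "derivation d (- p) = - derivation d p"
  using derivation_add[of d p "- p"] by (simp add: derivation_zero eq_neg_iff_add_eq_0 add.commute)

lemma derivation_diff: "derivation d (p - q) = derivation d p - derivation d q"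
  using derivation_add[of d p "- q"] by (simp add: derivation_uminus)

lemma UNIV_gen: "(UNIV :: gen set) = {Gen_alpha, Gen_A, Gen_B, Gen_C, Gen_E}"
  by (auto intro: gen.exhaust)

lemma finite_gen: "finite (M :: gen set)"
proof (rule finite_subset)
  show "finite (UNIV :: gen set)" unfolding UNIV_gen by simp
qed simp

lemma derivation_single:
  "derivation d (Poly_Mapping.single m c) = (\<Sum>v\<in>UNIV.
     Poly_Mapping.single (m - Poly_Mapping.single v 1) (of_nat (Poly_Mapping.lookup m v) * c) * d v)"
proof -
  have "derivation d (Poly_Mapping.single m c) = (\<Sum>v\<in>Poly_Mapping.keys m.
     Poly_Mapping.single (m - Poly_Mapping.single v 1) (of_nat (Poly_Mapping.lookup m v) * c) * d v)"
    by (subst derivation_superset[of "{m}"]) auto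
  also have "\<dots> = (\<Sum>v\<in>UNIV.
     Poly_Mapping.single (m - Poly_Mapping.single v 1) (of_nat (Poly_Mapping.lookup m v) * c) * d v)"
    by (intro sum.mono_neutral_left) (auto simp: in_keys_iff finite_gen)
  finally show ?thesis .
qed

lemma derivation_Const: "derivation d (Const c) = 0"
  by (simp add: Const_def derivation_single)

lemma derivation_Var: "derivation d (Var v) = d v"
proof -
  have "derivation d (Var v) = (\<Sum>w\<in>UNIV. if w = v then d v else 0)"
    unfolding Var_def derivation_single
    by (intro sum.cong) (auto simp: lookup_single when_def)
  then show ?thesis by (simp add: finite_gen)
qed

lemma derivation_mult_single:
  fixes m n :: "gen \<Rightarrow>\<^sub>0 nat"
  shows "derivation d (Poly_Mapping.single m a * Poly_Mapping.single n b) =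
     derivation d (Poly_Mapping.single m a) * Poly_Mapping.single n b
     + Poly_Mapping.single m a * derivation d (Poly_Mapping.single n b)"
proof -
  have sh: "Poly_Mapping.single (m + n - Poly_Mapping.single v 1)
        (of_nat (Poly_Mapping.lookup m v) * c)
     = Poly_Mapping.single (m - Poly_Mapping.single v 1 + n)
        (of_nat (Poly_Mapping.lookup m v) * c)" for m n :: "gen \<Rightarrow>\<^sub>0 nat" and v and c :: complex
  proof (cases "Poly_Mapping.lookup m v = 0")
    case False
    then have "m + n - Poly_Mapping.single v 1 = m - Poly_Mapping.single v 1 + n"
      by (intro poly_mapping_eqI) (auto simp: lookup_add lookup_minus lookup_single when_def)
    then show ?thesis by simp
  qed simp
  show ?thesis
    unfolding mult_single derivation_single sum_distrib_left sum_distrib_right sum.distrib[symmetric]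
  proof (intro sum.cong refl)
    fix v
    show "Poly_Mapping.single (m + n - Poly_Mapping.single v 1)
           (of_nat (Poly_Mapping.lookup (m + n) v) * (a * b)) * d v =
         Poly_Mapping.single (m - Poly_Mapping.single v 1) (of_nat (Poly_Mapping.lookup m v) * a) *
           d v * Poly_Mapping.single n b +
         Poly_Mapping.single m a *
          (Poly_Mapping.single (n - Poly_Mapping.single v 1) (of_nat (Poly_Mapping.lookup n v) * b) *
           d v)" (is "?l = ?r")
    proof -
      have "?r = (Poly_Mapping.single (m - Poly_Mapping.single v 1 + n)
             (of_nat (Poly_Mapping.lookup m v) * (a * b))
           + Poly_Mapping.single (n - Poly_Mapping.single v 1 + m)
             (of_nat (Poly_Mapping.lookup n v) * (a * b))) * d v"
        by (simp add: mult_single[symmetric] algebra_simps) (simp add: mult_single algebra_simps)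
      also have "\<dots> = (Poly_Mapping.single (m + n - Poly_Mapping.single v 1)
             (of_nat (Poly_Mapping.lookup m v) * (a * b))
           + Poly_Mapping.single (n + m - Poly_Mapping.single v 1)
             (of_nat (Poly_Mapping.lookup n v) * (a * b))) * d v"
        by (simp only: sh)
      also have "\<dots> = ?l"
        by (simp add: lookup_add distrib_right add.commute[of n m] flip: single_add)
      finally show ?thesis by simp
    qed
  qed
qed

lemma pol_expand:
  "p = (\<Sum>m\<in>Poly_Mapping.keys p. Poly_Mapping.single m (Poly_Mapping.lookup p m))"
  by (intro poly_mapping_eqI)
     (auto simp: lookup_sum lookup_single when_def in_keys_iff sum.delta')

lemma derivation_mult:
  "derivation d (p * q) = derivation d p * q + p * derivation d q"
proof -
  let ?s = "\<lambda>p m. Poly_Mapping.single m (Poly_Mapping.lookup p m) :: pol"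
  let ?P = "Poly_Mapping.keys p" and ?Q = "Poly_Mapping.keys q"
  have "derivation d (sum (?s p) ?P * sum (?s q) ?Q)
      = (\<Sum>m\<in>?P. \<Sum>n\<in>?Q. derivation d (?s p m * ?s q n))"
    by (simp add: sum_product derivation_sum)
  also have "\<dots> = (\<Sum>m\<in>?P. \<Sum>n\<in>?Q. derivation d (?s p m) * ?s q n + ?s p m * derivation d (?s q n))"
    by (simp only: derivation_mult_single)
  also have "\<dots> = derivation d (sum (?s p) ?P) * sum (?s q) ?Q
      + sum (?s p) ?P * derivation d (sum (?s q) ?Q)"
    by (simp add: sum.distrib sum_product derivation_sum)
  finally show ?thesis by (simp flip: pol_expand)
qed

lemma derivation_one: "derivation d 1 = 0"
  using derivation_mult[of d 1 1] by simp

lemma derivation_power4: "derivation d (p ^ 4) = 4 * p ^ 3 * derivation d p"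
  by (simp add: numeral_eq_Suc derivation_mult derivation_one algebra_simps)

lemma Const_eighth: "8 * Const (1/8) = 1"
proof -
  have "(8::pol) = Const 8"
    unfolding Const_def by (metis single_numeral)
  then have "8 * Const (1/8) = Const 8 * Const (1/8)" by simp
  also have "\<dots> = 1" by (simp add: Const_def mult_single del: single_numeral)
  finally show ?thesis .
qed

lemma dtau_rel_aux:
  fixes k a b A E :: "'a::comm_ring_1"
  assumes "8 * k = 1"
  shows "4 * b ^ 3 * (k * b * (E - A ^ 2)) + a * (1 - a) * A ^ 2 * A ^ 4
      - (1 - a) * (4 * A ^ 3 * (k * A * (E + (2 * a - 1) * A ^ 2)))
    = 4 * k * (E - A ^ 2) * (b ^ 4 - (1 - a) * A ^ 4)"
   and "4 * b ^ 3 * (k * b * (E + A ^ 2)) - a * (1 - a) * A ^ 2 * A ^ 4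
      - a * (4 * A ^ 3 * (k * A * (E + (2 * a - 1) * A ^ 2)))
    = 4 * k * (E + A ^ 2) * (b ^ 4 - a * A ^ 4)"
proof -
  have *: "a * (1 - a) * A ^ 2 * A ^ 4 = (8 * k) * (a * (1 - a) * A ^ 2 * A ^ 4)"
    using assms by simp
  show "4 * b ^ 3 * (k * b * (E - A ^ 2)) + a * (1 - a) * A ^ 2 * A ^ 4
      - (1 - a) * (4 * A ^ 3 * (k * A * (E + (2 * a - 1) * A ^ 2)))
    = 4 * k * (E - A ^ 2) * (b ^ 4 - (1 - a) * A ^ 4)"
    by (subst *) (simp add: algebra_simps eval_nat_numeral)
  show "4 * b ^ 3 * (k * b * (E + A ^ 2)) - a * (1 - a) * A ^ 2 * A ^ 4
      - a * (4 * A ^ 3 * (k * A * (E + (2 * a - 1) * A ^ 2)))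
    = 4 * k * (E + A ^ 2) * (b ^ 4 - a * A ^ 4)"
    by (subst *) (simp add: algebra_simps eval_nat_numeral)
qed

lemma dtau_rel:
  "derivation dtau_gen rel1 = 4 * Const (1/8) * (Var Gen_E - Var Gen_A ^ 2) * rel1"
  "derivation dtau_gen rel2 = 4 * Const (1/8) * (Var Gen_E + Var Gen_A ^ 2) * rel2"
proof -
  have "derivation dtau_gen rel1 = 4 * Var Gen_B ^ 3 * dtau_gen Gen_B
     + dtau_gen Gen_alpha * Var Gen_A ^ 4 - (1 - Var Gen_alpha) * (4 * Var Gen_A ^ 3 * dtau_gen Gen_A)"
    unfolding rel1_def
    by (simp only: derivation_diff derivation_mult derivation_power4 derivation_Var derivation_one)
       (simp add: algebra_simps)
  then show "derivation dtau_gen rel1 = 4 * Const (1/8) * (Var Gen_E - Var Gen_A ^ 2) * rel1"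
    unfolding dtau_gen.simps dtau_rel_aux[OF Const_eighth] by (simp add: rel1_def)
  have "derivation dtau_gen rel2 = 4 * Var Gen_C ^ 3 * dtau_gen Gen_C
     - dtau_gen Gen_alpha * Var Gen_A ^ 4 - Var Gen_alpha * (4 * Var Gen_A ^ 3 * dtau_gen Gen_A)"
    unfolding rel2_def
    by (simp only: derivation_diff derivation_mult derivation_power4 derivation_Var derivation_one)
       (simp add: algebra_simps)
  then show "derivation dtau_gen rel2 = 4 * Const (1/8) * (Var Gen_E + Var Gen_A ^ 2) * rel2"
    unfolding dtau_gen.simps dtau_rel_aux[OF Const_eighth] by (simp add: rel2_def)
qed

lemma ideal_QM_ideal: "ideal QM_ideal pol_ring"
  unfolding QM_ideal_def using cring_pol_ring
  by (intro ring.genideal_ideal) (auto simp: cring_def)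

lemma QM_ideal_closed:
  "p \<in> QM_ideal \<Longrightarrow> q \<in> QM_ideal \<Longrightarrow> p + q \<in> QM_ideal"
  "p \<in> QM_ideal \<Longrightarrow> r * p \<in> QM_ideal"
  "p \<in> QM_ideal \<Longrightarrow> - p \<in> QM_ideal"
proof -
  interpret ideal QM_ideal pol_ring by (rule ideal_QM_ideal)
  show "p \<in> QM_ideal \<Longrightarrow> q \<in> QM_ideal \<Longrightarrow> p + q \<in> QM_ideal"
    using additive_subgroup.a_closed[OF additive_subgroup_axioms, of p q] by simp
  show *: "p \<in> QM_ideal \<Longrightarrow> r * p \<in> QM_ideal" for r
    using I_l_closed[of p r] by simp
  show "p \<in> QM_ideal \<Longrightarrow> - p \<in> QM_ideal"
    using *[of "- 1"] by simp
qed

lemma QM_ideal_eq: "QM_ideal = {a * rel1 + b * rel2 | a b. True}" (is "_ = ?J")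
proof
  have gens: "rel1 \<in> QM_ideal" "rel2 \<in> QM_ideal"
    unfolding QM_ideal_def genideal_def by auto
  show "?J \<subseteq> QM_ideal"
    using gens by (auto intro!: QM_ideal_closed)
  have "ideal ?J pol_ring"
  proof (intro idealI)
    show "ring pol_ring" using cring_pol_ring by (simp add: cring_def)
    show "subgroup ?J (add_monoid pol_ring)"
    proof (intro group.subgroupI)
      show "Group.group (add_monoid pol_ring)"
        using cring_pol_ring abelian_group.a_group cring.axioms(1) ring.axioms(1) by blast
      show "?J \<noteq> {}" by auto
      fix x assume "x \<in> ?J"
      then obtain a b where x: "x = a * rel1 + b * rel2" by blast
      have "inv\<^bsub>add_monoid pol_ring\<^esub> x = - x"
        using \<open>Group.group (add_monoid pol_ring)\<close>
        by (intro group.inv_equality) auto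
      moreover have "- x = (- a) * rel1 + (- b) * rel2"
        by (simp add: x)
      ultimately show "inv\<^bsub>add_monoid pol_ring\<^esub> x \<in> ?J"
        unfolding mem_Collect_eq by metis
    next
      fix x y assume "x \<in> ?J" "y \<in> ?J"
      then obtain a b a' b' where "x = a * rel1 + b * rel2" "y = a' * rel1 + b' * rel2" by blast
      then have "x + y = (a + a') * rel1 + (b + b') * rel2"
        by (simp add: algebra_simps)
      then show "x \<otimes>\<^bsub>add_monoid pol_ring\<^esub> y \<in> ?J"
        by auto
    qed simp
  next
    fix p q assume "p \<in> ?J"
    then obtain a b where p: "p = a * rel1 + b * rel2" by blast
    have "q * p = (q * a) * rel1 + (q * b) * rel2"
      by (simp add: p algebra_simps)
    then show "q \<otimes>\<^bsub>pol_ring\<^esub> p \<in> ?J" "p \<otimes>\<^bsub>pol_ring\<^esub> q \<in> ?J"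
      by (auto simp: mult.commute[of p q])
  qed
  moreover have "rel1 = 1 * rel1 + 0 * rel2" "rel2 = 0 * rel1 + 1 * rel2"
    by simp_all
  then have "rel1 \<in> ?J" "rel2 \<in> ?J"
    by blast+
  ultimately show "QM_ideal \<subseteq> ?J"
    unfolding QM_ideal_def genideal_def by blast
qed

lemma zero_QM_ideal: "0 \<in> QM_ideal"
  unfolding QM_ideal_eq by (auto intro!: exI[of _ 0])

lemma dtau_QM_ideal: "p \<in> QM_ideal \<Longrightarrow> derivation dtau_gen p \<in> QM_ideal"
proof -
  assume "p \<in> QM_ideal"
  then obtain a b where p: "p = a * rel1 + b * rel2" by (auto simp: QM_ideal_eq)
  show ?thesis
    unfolding QM_ideal_eq p mem_Collect_eq derivation_add derivation_mult dtau_rel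
    by (intro exI[of _ "derivation dtau_gen a + a * (4 * Const (1/8) * (Var Gen_E - Var Gen_A ^ 2))"]
        exI[of _ "derivation dtau_gen b + b * (4 * Const (1/8) * (Var Gen_E + Var Gen_A ^ 2))"])
      (simp add: algebra_simps)
qed

lemma QM_class_eq: "QM_class p = {q. q - p \<in> QM_ideal}"
  unfolding QM_class_def a_r_coset_def r_coset_def by (force simp: algebra_simps)

lemma QM_class_eq_iff: "QM_class p = QM_class q \<longleftrightarrow> p - q \<in> QM_ideal"
proof
  show "QM_class p = QM_class q \<Longrightarrow> p - q \<in> QM_ideal"
    unfolding QM_class_eq using zero_QM_ideal by auto
  assume pq: "p - q \<in> QM_ideal"
  show "QM_class p = QM_class q"
    unfolding QM_class_eq
  proof (intro Collect_cong iffI)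
    fix x
    show "x - p \<in> QM_ideal \<Longrightarrow> x - q \<in> QM_ideal"
      using QM_ideal_closed(1)[OF _ pq, of "x - p"] by simp
    show "x - q \<in> QM_ideal \<Longrightarrow> x - p \<in> QM_ideal"
      using QM_ideal_closed(1)[OF _ QM_ideal_closed(3)[OF pq], of "x - q"] by simp
  qed
qed

theorem QM_dtau_class: "QM_dtau (QM_class p) = QM_class (derivation dtau_gen p)"
proof -
  have "QM_class (derivation dtau_gen q) = QM_class (derivation dtau_gen p)" if "q \<in> QM_class p" for q
    using that dtau_QM_ideal[of "q - p"]
    unfolding QM_class_eq_iff by (simp add: QM_class_eq derivation_diff)
  moreover have "p \<in> QM_class p"
    by (simp add: QM_class_eq zero_QM_ideal)
  ultimately show ?thesis
    unfolding QM_dtau_def by blast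
qed

end

theory Submission
  imports Defs
begin

text \<open>
  The functions \<open>\<alpha> = 64 z\<^sub>1\<^sup>2 z\<^sub>2 / (1 - 4 z\<^sub>1)\<^sup>2\<close>, \<open>A = (2 (1 - 4 z\<^sub>1))\<^bsup>1/2\<^esup> s\<^sub>4\<^sub>4\<close>,
  \<open>B = (4 Y\<^sub>1\<^sub>1\<^sub>1\<^sup>-\<^sup>1)\<^bsup>1/4\<^esup> s\<^sub>4\<^sub>4\<close>, \<open>C = (256 z\<^sub>1\<^sup>2 z\<^sub>2)\<^bsup>1/4\<^esup> s\<^sub>4\<^sub>4\<close> and
  \<open>E = - 8 s\<^sub>4\<^sub>3 s\<^sub>4\<^sub>4 + 2 s\<^sub>4\<^sub>4\<^sup>2 (2 Y\<^sub>1\<^sub>1\<^sub>1\<^sup>-\<^sup>1 - (1 - 4 z\<^sub>1))\<close> generate the copy of \<open>R\<^sub>2\<close>. The Picard--Fuchs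
  equations and flatness determine the connection matrix, and rows 3 and 4 of the matrix of \<open>\<nabla>\<^sub>R\<close> then
  determine the derivatives of the generators along \<open>R\<close>. These rows are \<open>(0, 0, 0, k)\<close> and \<open>0\<close> with \<open>k = 1\<close>
  for \<open>R\<^sub>1\<close> and \<open>k = 0\<close> for \<open>R\<^sub>2\<close>, and the derivation turns out to be \<open>k \<partial>\<^sub>\<tau>\<close>; so the second
  vector field annihilates the whole subring.

  For injectivity, the relations reduce the exponents of \<open>B\<close> and \<open>C\<close> below 4. Varying \<open>s\<^sub>4\<^sub>3\<close> and \<open>s\<^sub>4\<^sub>4\<close>
  separates the powers of \<open>E\<close> and the total degrees in \<open>A, B, C\<close>. What remains is the linear independence
  of the functions \<open>\<alpha>\<^sup>i b\<^sup>k c\<^sup>l\<close> with \<open>k, l < 4\<close>, \<open>b = B/A\<close>, \<open>c = C/A\<close> and \<open>\<alpha> = 1 - b\<^sup>4\<close> on the Fermat quartic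
  \<open>b\<^sup>4 + c\<^sup>4 = 1\<close>; this holds because \<open>1 - b\<^sup>4\<close> has a simple zero.
\<close>


section \<open>Complex directional derivatives\<close>

text \<open>A complex-linear total derivative is bundled with its value in one direction. The
  calculus rules then chain by resolution, and only numbers along a vector field have to be
  carried.\<close>

definition holo_deriv :: "(complex^'n \<Rightarrow> complex) \<Rightarrow> complex^'n \<Rightarrow> complex^'n \<Rightarrow> complex \<Rightarrow> bool" where
  "holo_deriv f x v d \<longleftrightarrow>
     (\<exists>f'. (f has_derivative f') (at x) \<and> Vector_Spaces.linear (*s) (*) f' \<and> f' v = d)"

lemma linear_complex_iff:
  "Vector_Spaces.linear (*s) (*) (f :: complex^'n \<Rightarrow> complex) \<longleftrightarrow>
     (\<forall>x y. f (x + y) = f x + f y) \<and> (\<forall>c x. f (c *s x) = c * f x)"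
proof -
  have "vector_space ((*) :: complex \<Rightarrow> complex \<Rightarrow> complex)"
    by unfold_locales (auto simp: algebra_simps)
  then show ?thesis
    by (simp add: Vector_Spaces.linear_iff vec.vector_space_axioms)
qed

text \<open>The value \<open>d\<close> is quantified, so any fixed direction does; later proofs take
  \<open>v = 0\<close>.\<close>

lemma holo_on_iff_holo_deriv: "holo_on f S \<longleftrightarrow> (\<forall>x\<in>S. \<exists>d. holo_deriv f x v d)"
  unfolding holo_on_def holo_deriv_def by blast

lemma holo_on_holo_deriv: "holo_on f S \<Longrightarrow> x \<in> S \<Longrightarrow> \<exists>d. holo_deriv f x v d"
  unfolding holo_on_def holo_deriv_def by blast

lemma frechet_holo_deriv: "holo_deriv f x v d \<Longrightarrow> frechet_derivative f (at x) v = d"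
  unfolding holo_deriv_def using frechet_derivative_at by metis

lemma holo_deriv_unique: "holo_deriv f x v d \<Longrightarrow> holo_deriv f x v e \<Longrightarrow> d = e"
  using frechet_holo_deriv by metis

lemma holo_deriv_cong:
  assumes "holo_deriv f x v d" "open S" "x \<in> S" "\<And>y. y \<in> S \<Longrightarrow> f y = g y"
  shows "holo_deriv g x v d"
  using assms has_derivative_transform_within_open[of f _ x UNIV S g]
  unfolding holo_deriv_def by blast

lemma holo_deriv_const: "holo_deriv (\<lambda>_. c) x v 0"
  unfolding holo_deriv_def linear_complex_iff
  by (intro exI[of _ "\<lambda>_. 0"]) auto

lemma holo_deriv_nth: "holo_deriv (\<lambda>x. x $ i) x v (v $ i)"
  unfolding holo_deriv_def linear_complex_iff
  by (intro exI[of _ "\<lambda>v. v $ i"]) (auto intro: bounded_linear_imp_has_derivative bounded_linear_vec_nth)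

lemma holo_deriv_add:
  assumes "holo_deriv f x v d" "holo_deriv g x v e"
  shows "holo_deriv (\<lambda>x. f x + g x) x v (d + e)"
proof -
  obtain f' g' where "(f has_derivative f') (at x)" "Vector_Spaces.linear (*s) (*) f'" "f' v = d"
    "(g has_derivative g') (at x)" "Vector_Spaces.linear (*s) (*) g'" "g' v = e"
    using assms unfolding holo_deriv_def by blast
  then show ?thesis
    unfolding holo_deriv_def linear_complex_iff
    by (intro exI[of _ "\<lambda>v. f' v + g' v"]) (auto intro: has_derivative_add simp: algebra_simps)
qed

lemma holo_deriv_mult:
  assumes "holo_deriv f x v d" "holo_deriv g x v e"
  shows "holo_deriv (\<lambda>x. f x * g x) x v (f x * e + d * g x)"
proof -
  obtain f' g' where "(f has_derivative f') (at x)" "Vector_Spaces.linear (*s) (*) f'" "f' v = d"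
    "(g has_derivative g') (at x)" "Vector_Spaces.linear (*s) (*) g'" "g' v = e"
    using assms unfolding holo_deriv_def by blast
  then show ?thesis
    unfolding holo_deriv_def linear_complex_iff
    by (intro exI[of _ "\<lambda>v. f x * g' v + f' v * g x"])
      (auto intro: has_derivative_mult simp: algebra_simps)
qed

lemma holo_deriv_chain:
  assumes "holo_deriv f x v d" "(h has_field_derivative c) (at (f x))"
  shows "holo_deriv (\<lambda>x. h (f x)) x v (c * d)"
proof -
  obtain f' where f': "(f has_derivative f') (at x)" "Vector_Spaces.linear (*s) (*) f'" "f' v = d"
    using assms unfolding holo_deriv_def by blast
  have "((\<lambda>x. h (f x)) has_derivative (\<lambda>v. c * f' v)) (at x)"
    using has_derivative_compose[OF f'(1), of h "(*) c"] assms(2)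
    by (simp add: has_field_derivative_def)
  then show ?thesis
    using f' unfolding holo_deriv_def linear_complex_iff
    by (intro exI[of _ "\<lambda>v. c * f' v"]) (auto simp: algebra_simps)
qed

lemma holo_deriv_uminus: "holo_deriv f x v d \<Longrightarrow> holo_deriv (\<lambda>x. - f x) x v (- d)"
  using holo_deriv_mult[OF holo_deriv_const[of "-1"], of f x v d] by simp

lemma holo_deriv_diff:
  "holo_deriv f x v d \<Longrightarrow> holo_deriv g x v e \<Longrightarrow> holo_deriv (\<lambda>x. f x - g x) x v (d - e)"
  using holo_deriv_add[OF _ holo_deriv_uminus, of f x v d g e] by simp

lemma holo_deriv_inverse:
  "holo_deriv f x v d \<Longrightarrow> f x \<noteq> 0 \<Longrightarrow> holo_deriv (\<lambda>x. inverse (f x)) x v (- d / (f x)\<^sup>2)"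
  using holo_deriv_chain[of f x v d inverse "- (inverse (f x) * 1 * inverse (f x))"]
  by (force intro!: derivative_eq_intros simp: power2_eq_square divide_simps)

lemma holo_deriv_divide:
  "holo_deriv f x v d \<Longrightarrow> holo_deriv g x v e \<Longrightarrow> g x \<noteq> 0 \<Longrightarrow>
     holo_deriv (\<lambda>x. f x / g x) x v ((d * g x - f x * e) / (g x)\<^sup>2)"
  using holo_deriv_mult[OF _ holo_deriv_inverse, of f x v d g e]
  by (simp add: divide_inverse[symmetric] field_simps power2_eq_square)

lemma holo_deriv_power:
  "holo_deriv f x v d \<Longrightarrow> holo_deriv (\<lambda>x. f x ^ n) x v (of_nat n * f x ^ (n - 1) * d)"
  by (rule holo_deriv_chain) (auto intro!: derivative_eq_intros)

lemmas holo_deriv_intros =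
  holo_deriv_const holo_deriv_nth holo_deriv_add holo_deriv_diff holo_deriv_uminus
  holo_deriv_mult holo_deriv_divide holo_deriv_power

lemma holo_deriv_eqI: "holo_deriv f x v d \<Longrightarrow> d = e \<Longrightarrow> holo_deriv f x v e"
  by simp

section \<open>Vector-valued and matrix-valued maps, componentwise\<close>

lemma has_derivative_vecI:
  fixes f :: "'a::real_normed_vector \<Rightarrow> ('b::real_normed_vector)^'n"
  assumes "\<And>i. ((\<lambda>x. f x $ i) has_derivative (\<lambda>v. f' v $ i)) (at x)"
  shows "(f has_derivative f') (at x)"
proof -
  have lin: "linear (\<lambda>v. f' v $ i)" for i
    using assms[of i] has_derivative_linear by blast
  have "linear f'"
    using lin by (auto simp: linear_iff vec_eq_iff)
  moreover obtain K where K: "\<And>i v. norm (f' v $ i) \<le> norm v * K i"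
    using assms[THEN has_derivative_bounded_linear, THEN bounded_linear.bounded] by metis
  moreover have "norm (f' v) \<le> norm v * (\<Sum>i\<in>UNIV. K i)" for v
  proof -
    have "norm (f' v) \<le> (\<Sum>i\<in>UNIV. norm (f' v $ i))"
      by (simp add: norm_vec_def L2_set_le_sum)
    also have "\<dots> \<le> (\<Sum>i\<in>UNIV. norm v * K i)"
      by (intro sum_mono K)
    finally show ?thesis by (simp add: sum_distrib_left)
  qed
  ultimately have "bounded_linear f'"
    by (auto simp: bounded_linear_def bounded_linear_axioms_def)
  moreover have "((\<lambda>y. (f y - f x - f' (y - x)) /\<^sub>R norm (y - x)) \<longlongrightarrow> 0) (at x)"
    using assms by (intro vec_tendstoI) (simp add: has_derivative_at_within)
  ultimately show ?thesis
    by (simp add: has_derivative_at_within)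
qed

lemma frechet_derivative_vec_nth:
  fixes f :: "complex^'m \<Rightarrow> complex^'n"
  assumes "\<And>i. holo_deriv (\<lambda>x. f x $ i) x v (d i)"
  shows "frechet_derivative f (at x) v = (\<chi> i. d i)"
proof -
  obtain f' where f': "\<And>i. ((\<lambda>x. f x $ i) has_derivative f' i) (at x)" "\<And>i. f' i v = d i"
    using assms unfolding holo_deriv_def by metis
  have "(f has_derivative (\<lambda>v. \<chi> i. f' i v)) (at x)"
    by (intro has_derivative_vecI) (simp add: f')
  from frechet_derivative_at[OF this] show ?thesis
    by (simp add: f' fun_eq_iff flip: f'(2))
qed

lemma frechet_derivative_mat_nth:
  fixes f :: "complex^'m \<Rightarrow> complex^'n^'k"
  assumes "\<And>i j. holo_deriv (\<lambda>x. f x $ i $ j) x v (d i j)"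
  shows "frechet_derivative f (at x) v = (\<chi> i j. d i j)"
proof -
  obtain f' where f': "\<And>i j. ((\<lambda>x. f x $ i $ j) has_derivative f' i j) (at x)" "\<And>i j. f' i j v = d i j"
    using assms unfolding holo_deriv_def by metis
  have "(f has_derivative (\<lambda>v. \<chi> i j. f' i j v)) (at x)"
    by (intro has_derivative_vecI) (simp add: f')
  from frechet_derivative_at[OF this] show ?thesis
    by (simp add: fun_eq_iff vec_eq_iff f'(2) flip: f'(2))
qed

text \<open>
  A continuous logarithm \<open>g\<close> of \<open>f\<close> is given by \<open>g(x) + Ln (f / f(x))\<close> near \<open>x\<close>, hence holomorphic.
\<close>

lemma holo_deriv_log:
  assumes f: "holo_deriv f x v d" and S: "open S" "x \<in> S"
    and g: "continuous_on S g" "\<And>y. y \<in> S \<Longrightarrow> f y = exp (g y)"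
  shows "holo_deriv g x v (d / f x)"
proof -
  have fx: "f x \<noteq> 0" using g S by simp
  have "isCont g x"
    using g S continuous_on_eq_continuous_at by blast
  then obtain e where e: "e > 0" "\<And>y. dist y x < e \<Longrightarrow> dist (g y) (g x) < 1"
    unfolding continuous_at_eps_delta by (metis zero_less_one)
  have *: "g x + Ln (f y / f x) = g y" if "y \<in> S \<inter> ball x e" for y
  proof -
    \<comment> \<open>The bound 1 < pi keeps \<open>g y - g x\<close> in the strip on which
      \<open>Ln\<close> inverts \<open>exp\<close>, so no multiple of 2 pi i can enter.\<close>
    have "\<bar>Im (g y - g x)\<bar> < 1"
      using e(2)[of y] that abs_Im_le_cmod[of "g y - g x"] by (simp add: dist_norm norm_minus_commute)
    then have "Ln (exp (g y - g x)) = g y - g x"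
      using pi_gt3 by (intro Ln_exp) linarith+
    then show ?thesis using that g(2) S by (simp add: exp_diff)
  qed
  have "holo_deriv (\<lambda>y. g x + Ln (f y / f x)) x v (d / f x)"
  proof (rule holo_deriv_eqI)
    show "holo_deriv (\<lambda>y. g x + Ln (f y / f x)) x v (0 + inverse (f x / f x) * ((d * f x - f x * 0) / (f x)\<^sup>2))"
      using fx by (intro holo_deriv_intros holo_deriv_chain[where h = Ln] f has_field_derivative_Ln) auto
  qed (use fx in \<open>simp add: power2_eq_square\<close>)
  then show ?thesis
    by (rule holo_deriv_cong[of _ _ _ _ "S \<inter> ball x e"]) (use S e * in auto)
qed

text \<open>A nowhere vanishing function on a simply connected open set has a continuous logarithm
  g, which is holomorphic by \<open>holo_deriv_log\<close>; the root is exp(g/n).\<close>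

lemma holo_root_exists:
  assumes V: "open V" "simply_connected V" and f: "holo_on f V" "\<And>z. z \<in> V \<Longrightarrow> f z \<noteq> 0" and n: "n > 0"
  shows "\<exists>r. holo_on r V \<and> (\<forall>z\<in>V. r z ^ n = f z)"
proof -
  have "f differentiable (at z)" if "z \<in> V" for z
    using f(1) that unfolding holo_on_def differentiable_def by blast
  then have "continuous_on V f"
    using V(1) by (simp add: continuous_on_eq_continuous_at differentiable_imp_continuous_within)
  then obtain g where g: "continuous_on V g" "\<And>z. z \<in> V \<Longrightarrow> f z = exp (g z)"
    using continuous_logarithm_on_simply_connected[of V f] V f(2) open_imp_locally_path_connected
    by blast
  have "holo_on (\<lambda>z. exp (g z / of_nat n)) V"
    unfolding holo_on_iff_holo_deriv[where v = 0]
  proof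
    fix z assume z: "z \<in> V"
    obtain d where "holo_deriv f z 0 d" using holo_on_holo_deriv f(1) z by blast
    then have "holo_deriv g z 0 (d / f z)" using V(1) z g by (rule holo_deriv_log)
    from holo_deriv_chain[OF holo_deriv_divide[OF this holo_deriv_const, of "of_nat n"], OF _ DERIV_exp]
    show "\<exists>d. holo_deriv (\<lambda>z. exp (g z / of_nat n)) z 0 d" using n by auto
  qed
  moreover have "exp (g z / of_nat n) ^ n = f z" if "z \<in> V" for z
    using g(2)[OF that] n by (simp flip: exp_of_nat_mult)
  ultimately show ?thesis by blast
qed


section \<open>Evaluation of polynomials in the generators\<close>

text \<open>The product runs over all generators and not over the support of \<open>m\<close>, so
  that exponents add under multiplication without case distinctions.\<close>

definition ev :: "(gen \<Rightarrow> complex) \<Rightarrow> pol \<Rightarrow> complex" where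
  "ev G p = (\<Sum>m\<in>Poly_Mapping.keys p. Poly_Mapping.lookup p m * (\<Prod>v\<in>UNIV. G v ^ Poly_Mapping.lookup m v))"

lemma ev_superset:
  assumes "finite M" "Poly_Mapping.keys p \<subseteq> M"
  shows "ev G p = (\<Sum>m\<in>M. Poly_Mapping.lookup p m * (\<Prod>v\<in>UNIV. G v ^ Poly_Mapping.lookup m v))"
  unfolding ev_def using assms by (intro sum.mono_neutral_left) (auto simp: in_keys_iff)

lemma ev_add: "ev G (p + q) = ev G p + ev G q"
proof -
  let ?M = "Poly_Mapping.keys p \<union> Poly_Mapping.keys q"
  have "Poly_Mapping.keys (p + q) \<subseteq> ?M" by (rule Poly_Mapping.keys_add)
  then show ?thesis
    by (simp add: ev_superset[of ?M] lookup_add distrib_right sum.distrib)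
qed

lemma ev_zero: "ev G 0 = 0"
  by (simp add: ev_def)

lemma ev_sum: "ev G (sum f I) = (\<Sum>i\<in>I. ev G (f i))"
  by (induction I rule: infinite_finite_induct) (auto simp: ev_zero ev_add)

lemma ev_single: "ev G (Poly_Mapping.single m c) = c * (\<Prod>v\<in>UNIV. G v ^ Poly_Mapping.lookup m v)"
  by (subst ev_superset[of "{m}"]) auto

lemma ev_mult: "ev G (p * q) = ev G p * ev G q"
proof -
  let ?s = "\<lambda>p m. Poly_Mapping.single m (Poly_Mapping.lookup p m) :: pol"
  let ?P = "Poly_Mapping.keys p" and ?Q = "Poly_Mapping.keys q"
  have "ev G (sum (?s p) ?P * sum (?s q) ?Q) = ev G (sum (?s p) ?P) * ev G (sum (?s q) ?Q)"
    by (simp add: sum_product ev_sum ev_single mult_single lookup_add power_add prod.distrib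
        mult.assoc mult.left_commute)
  then show ?thesis by (simp flip: pol_expand)
qed

lemma ev_Const: "ev G (Const c) = c"
  by (simp add: Const_def ev_single)

lemma ev_one: "ev G 1 = 1"
  using ev_Const[of G 1] by (simp add: Const_def)

lemma ev_Var: "ev G (Var v) = G v"
proof -
  have "ev G (Var v) = (\<Prod>w\<in>UNIV. if w = v then G w else 1)"
    unfolding Var_def ev_single mult_1
    by (intro prod.cong) (auto simp: lookup_single when_def)
  then show ?thesis by (simp add: finite_gen)
qed

lemma ev_uminus: "ev G (- p) = - ev G p"
  using ev_add[of G p "- p"] by (simp add: ev_zero eq_neg_iff_add_eq_0 add.commute)

lemma ev_diff: "ev G (p - q) = ev G p - ev G q"
  using ev_add[of G p "- q"] by (simp add: ev_uminus)

lemma ev_power: "ev G (p ^ n) = ev G p ^ n"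
  by (induction n) (auto simp: ev_one ev_mult)

lemma ev_numeral: "ev G (numeral n) = numeral n"
  using ev_Const[of G "numeral n"] by (simp add: Const_def)

lemmas ev_simps = ev_add ev_diff ev_mult ev_power ev_Const ev_Var ev_one ev_zero ev_numeral

text \<open>Every monomial is a constant times a product of powers of variables. The rule serves to
  extend a derivative along a vector field from the generators to all polynomials.\<close>

lemma pol_induct [case_names Const Var add mult]:
  assumes C: "\<And>c. P (Const c)" and V: "\<And>v. P (Var v)"
    and add: "\<And>p q. P p \<Longrightarrow> P q \<Longrightarrow> P (p + q)" and mult: "\<And>p q. P p \<Longrightarrow> P q \<Longrightarrow> P (p * q)"
  shows "P p"
proof -
  have one: "P 1" using C[of 1] by (simp add: Const_def)
  have pow: "P (q ^ n)" if "P q" for q n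
    by (induction n) (auto intro: one mult that)
  have single: "P (Poly_Mapping.single m c)" for m c
  proof -
    have Var_pow: "Var v ^ n = Poly_Mapping.single (Poly_Mapping.single v n) 1" for v n
      by (induction n) (simp_all add: Var_def mult_single flip: single_add)
    have "(\<Prod>v\<in>W. Var v ^ Poly_Mapping.lookup m v)
        = Poly_Mapping.single (\<Sum>v\<in>W. Poly_Mapping.single v (Poly_Mapping.lookup m v)) 1" for W
      by (induction W rule: infinite_finite_induct) (auto simp: Var_pow mult_single)
    moreover have "(\<Sum>v\<in>UNIV. Poly_Mapping.single v (Poly_Mapping.lookup m v)) = m"
      by (intro poly_mapping_eqI) (simp add: lookup_sum lookup_single when_def finite_gen)
    ultimately have "Poly_Mapping.single m c = Const c * (\<Prod>v\<in>UNIV. Var v ^ Poly_Mapping.lookup m v)"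
      by (simp add: Const_def mult_single)
    moreover have "P (\<Prod>v\<in>W. Var v ^ Poly_Mapping.lookup m v)" for W
      by (induction W rule: infinite_finite_induct) (auto intro: one pow V mult)
    ultimately show ?thesis by (auto intro: C mult)
  qed
  have "P (\<Sum>m\<in>M. Poly_Mapping.single m (Poly_Mapping.lookup p m))" for M
    by (induction M rule: infinite_finite_induct) (use C[of 0] in \<open>auto simp: Const_def intro: single add\<close>)
  then show ?thesis by (metis pol_expand)
qed

lemma ev_QM_ideal:
  assumes "ev G rel1 = 0" "ev G rel2 = 0" "p \<in> QM_ideal"
  shows "ev G p = 0"
  using assms by (auto simp: QM_ideal_eq ev_simps)

section \<open>The quotient ring through representatives\<close>

lemma carrier_QM_ring: "carrier QM_ring = range QM_class"
  unfolding QM_ring_def FactRing_def QM_class_def by (auto simp: A_RCOSETS_def')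

lemma QM_ring_simps:
  "QM_class p \<otimes>\<^bsub>QM_ring\<^esub> QM_class q = QM_class (p * q)"
  "QM_class p \<oplus>\<^bsub>QM_ring\<^esub> QM_class q = QM_class (p + q)"
  "\<one>\<^bsub>QM_ring\<^esub> = QM_class 1"
proof -
  interpret ideal QM_ideal pol_ring by (rule ideal_QM_ideal)
  show "QM_class p \<otimes>\<^bsub>QM_ring\<^esub> QM_class q = QM_class (p * q)"
    "QM_class p \<oplus>\<^bsub>QM_ring\<^esub> QM_class q = QM_class (p + q)"
    "\<one>\<^bsub>QM_ring\<^esub> = QM_class 1"
    using rcoset_mult_add[of p q] a_rcos_sum[of p q]
    by (simp_all add: QM_ring_def FactRing_def QM_class_def)
qed

section \<open>Normal forms modulo the relations\<close>

text \<open>Modulo the relations, B^4 becomes A^4 - \<alpha> A^4 and C^4 becomes \<alpha> A^4. Each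
  replacement lowers the sum of the exponents of B and C by 4, so the process stops.\<close>

lemma monomial_reduced_representative:
  "\<exists>n. (\<forall>k\<in>Poly_Mapping.keys n. Poly_Mapping.lookup k Gen_B < 4 \<and> Poly_Mapping.lookup k Gen_C < 4)
     \<and> Poly_Mapping.single m c - n \<in> QM_ideal"
proof (induction "Poly_Mapping.lookup m Gen_B + Poly_Mapping.lookup m Gen_C" arbitrary: m c rule: less_induct)
  case less
  let ?R = "\<lambda>n::pol. \<forall>k\<in>Poly_Mapping.keys n. Poly_Mapping.lookup k Gen_B < 4 \<and> Poly_Mapping.lookup k Gen_C < 4"
  have pow4: "Var v ^ 4 = Poly_Mapping.single (Poly_Mapping.single v 4) 1" for v
    by (simp add: Var_def mult_single numeral_eq_Suc flip: single_add)
  have split: "Poly_Mapping.single m c = Poly_Mapping.single (m - Poly_Mapping.single v 4) c * Var v ^ 4"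
    if "Poly_Mapping.lookup m v \<ge> 4" for v
  proof -
    have "m = (m - Poly_Mapping.single v 4) + Poly_Mapping.single v 4"
      using that by (intro poly_mapping_eqI) (auto simp: lookup_add lookup_minus lookup_single when_def)
    then show ?thesis by (metis mult_single pow4 mult.right_neutral)
  qed
  have gens: "r * rel1 \<in> QM_ideal" "r * rel2 \<in> QM_ideal" for r
  proof -
    have "rel1 \<in> QM_ideal" "rel2 \<in> QM_ideal"
      unfolding QM_ideal_def genideal_def by auto
    then show "r * rel1 \<in> QM_ideal" "r * rel2 \<in> QM_ideal"
      by (auto intro: QM_ideal_closed(2))
  qed
  have comb: "\<exists>n. ?R n \<and> p - n \<in> QM_ideal"
    if "p - (q1 + q2) \<in> QM_ideal" "\<exists>n. ?R n \<and> q1 - n \<in> QM_ideal" "\<exists>n. ?R n \<and> q2 - n \<in> QM_ideal"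
    for p q1 q2
  proof -
    from that obtain n1 n2 where n: "?R n1" "q1 - n1 \<in> QM_ideal" "?R n2" "q2 - n2 \<in> QM_ideal" by blast
    have "?R (n1 + n2)" using n Poly_Mapping.keys_add[of n1 n2] by blast
    moreover have "p - (n1 + n2) \<in> QM_ideal"
      using QM_ideal_closed(1)[OF that(1) QM_ideal_closed(1)[OF n(2,4)]] by (simp add: algebra_simps)
    ultimately show ?thesis by blast
  qed
  show ?case
  proof (cases "Poly_Mapping.lookup m Gen_B < 4 \<and> Poly_Mapping.lookup m Gen_C < 4")
    case True
    then show ?thesis
      by (intro exI[of _ "Poly_Mapping.single m c"]) (auto simp: zero_QM_ideal split: if_splits)
  next
    case False
    let ?a = "Poly_Mapping.single Gen_A 4 :: gen \<Rightarrow>\<^sub>0 nat" and ?al = "Poly_Mapping.single Gen_alpha 1 :: gen \<Rightarrow>\<^sub>0 nat"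
    consider (B) "Poly_Mapping.lookup m Gen_B \<ge> 4" | (C) "Poly_Mapping.lookup m Gen_C \<ge> 4"
      using False by linarith
    then show ?thesis
    proof cases
      case B
      let ?m = "m - Poly_Mapping.single Gen_B 4"
      let ?X = "Poly_Mapping.single ?m c"
      have "Poly_Mapping.single (?m + ?a) c = ?X * Var Gen_A ^ 4"
        unfolding pow4 mult_single by simp
      moreover have "Poly_Mapping.single (?m + ?a + ?al) (- c) = - (?X * Var Gen_A ^ 4 * Var Gen_alpha)"
        unfolding pow4[of Gen_A] Var_def[of Gen_alpha] mult_single by (simp add: single_uminus)
      ultimately have "Poly_Mapping.single m c - (Poly_Mapping.single (?m + ?a) c + Poly_Mapping.single (?m + ?a + ?al) (- c))
          = ?X * rel1"
        unfolding split[OF B] rel1_def by (simp only:) (simp add: algebra_simps)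
      then have "Poly_Mapping.single m c - (Poly_Mapping.single (?m + ?a) c + Poly_Mapping.single (?m + ?a + ?al) (- c))
          \<in> QM_ideal"
        using gens(1) by simp
      from comb[OF this less less] show ?thesis
        using B by (simp add: lookup_add lookup_minus lookup_single)
    next
      case C
      let ?m = "m - Poly_Mapping.single Gen_C 4"
      let ?X = "Poly_Mapping.single ?m c"
      have "Poly_Mapping.single (?m + ?a + ?al) c = ?X * Var Gen_A ^ 4 * Var Gen_alpha"
        unfolding pow4[of Gen_A] Var_def[of Gen_alpha] mult_single by simp
      \<comment> \<open>The summand 0 fits the single replacement term into \<open>comb\<close>,
        which expects two.\<close>
      then have "Poly_Mapping.single m c - (Poly_Mapping.single (?m + ?a + ?al) c + 0) = ?X * rel2"
        unfolding split[OF C] rel2_def by (simp only:) (simp add: algebra_simps)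
      then have "Poly_Mapping.single m c - (Poly_Mapping.single (?m + ?a + ?al) c + 0) \<in> QM_ideal"
        using gens(2) by simp
      note mem = comb[OF this less]
      have "\<exists>n. ?R n \<and> 0 - n \<in> QM_ideal"
        by (intro exI[of _ 0]) (simp add: zero_QM_ideal)
      from mem[OF _ this] show ?thesis
        using C by (simp add: lookup_add lookup_minus lookup_single)
    qed
  qed
qed

lemma reduced_representative:
  "\<exists>n. (\<forall>k\<in>Poly_Mapping.keys n. Poly_Mapping.lookup k Gen_B < 4 \<and> Poly_Mapping.lookup k Gen_C < 4)
     \<and> p - n \<in> QM_ideal"
proof -
  have "\<exists>n. \<forall>m. (\<forall>k\<in>Poly_Mapping.keys (n m). Poly_Mapping.lookup k Gen_B < 4 \<and> Poly_Mapping.lookup k Gen_C < 4)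
      \<and> Poly_Mapping.single m (Poly_Mapping.lookup p m) - n m \<in> QM_ideal"
    by (intro choice allI monomial_reduced_representative)
  then obtain n where n: "\<And>m. \<forall>k\<in>Poly_Mapping.keys (n m). Poly_Mapping.lookup k Gen_B < 4 \<and> Poly_Mapping.lookup k Gen_C < 4"
    "\<And>m. Poly_Mapping.single m (Poly_Mapping.lookup p m) - n m \<in> QM_ideal"
    by auto
  let ?n = "\<Sum>m\<in>Poly_Mapping.keys p. n m"
  have "(\<Sum>m\<in>M. Poly_Mapping.single m (Poly_Mapping.lookup p m) - n m) \<in> QM_ideal" for M
    by (induction M rule: infinite_finite_induct) (auto simp: zero_QM_ideal n intro: QM_ideal_closed)
  from this[of "Poly_Mapping.keys p"] have "p - ?n \<in> QM_ideal"
    by (simp add: sum_subtractf flip: pol_expand)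
  moreover have "Poly_Mapping.keys ?n \<subseteq> (\<Union>m\<in>Poly_Mapping.keys p. Poly_Mapping.keys (n m))"
    by (rule Poly_Mapping.keys_sum)
  ultimately show ?thesis using n(1) by (intro exI[of _ ?n]) blast
qed


section \<open>Linear independence on the Fermat quartic\<close>

text \<open>Among the terms with nonzero coefficient, the one of largest degree would contribute a
  leading coefficient that no other term can cancel.\<close>

lemma sum_distinct_degrees:
  fixes P :: "'b \<Rightarrow> 'a::idom poly"
  assumes M: "finite M" and inj: "inj_on (\<lambda>m. degree (P m)) M" and nz: "\<And>m. m \<in> M \<Longrightarrow> P m \<noteq> 0"
    and sum: "(\<Sum>m\<in>M. smult (f m) (P m)) = 0" and m: "m \<in> M"
  shows "f m = 0"
proof (rule ccontr)
  let ?N = "{m\<in>M. f m \<noteq> 0}"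
  assume "f m \<noteq> 0"
  then have N: "finite ?N" "?N \<noteq> {}" using M m by auto
  obtain k where k: "k \<in> ?N" "\<And>n. n \<in> ?N \<Longrightarrow> degree (P n) \<le> degree (P k)"
    using Max_in[of "(\<lambda>m. degree (P m)) ` ?N"] Max_ge[of "(\<lambda>m. degree (P m)) ` ?N"] N
    by (smt (verit) finite_imageI imageE image_eqI image_is_empty)
  have "coeff (smult (f n) (P n)) (degree (P k)) = 0" if n: "n \<in> M" "n \<noteq> k" for n
  proof (cases "f n = 0")
    case False
    then have "degree (P n) < degree (P k)"
      using k n inj by (metis (mono_tags, lifting) inj_on_eq_iff le_neq_implies_less mem_Collect_eq)
    then show ?thesis by (simp add: coeff_eq_0)
  qed simp
  then have "(\<Sum>n\<in>M. coeff (smult (f n) (P n)) (degree (P k)))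
      = (\<Sum>n\<in>{k}. coeff (smult (f n) (P n)) (degree (P k)))"
    using M k by (intro sum.mono_neutral_right) auto
  moreover have "(\<Sum>n\<in>M. coeff (smult (f n) (P n)) (degree (P k))) = 0"
    using sum by (metis coeff_0 coeff_sum)
  ultimately show False using k nz by auto
qed

lemma poly_eq_0_infinite:
  fixes p :: "'a::idom poly"
  assumes "infinite X" "\<And>x. x \<in> X \<Longrightarrow> poly p x = 0"
  shows "p = 0"
  using assms poly_roots_finite[of p] by (metis (mono_tags, lifting) finite_subset mem_Collect_eq subsetI)

text \<open>A one-variable polynomial with infinitely many zeros is zero, and its coefficients are
  the sums over the fibres of the exponent map \<open>e\<close>. This separates first the powers of
  E, then the total degrees in A, B, C.\<close>

lemma sum_powers_infinite:
  fixes g :: "'b \<Rightarrow> 'a::idom"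
  assumes M: "finite M" and X: "infinite X" "\<And>x. x \<in> X \<Longrightarrow> (\<Sum>m\<in>M. g m * x ^ e m) = 0"
  shows "(\<Sum>m\<in>{m\<in>M. e m = k}. g m) = 0"
proof -
  let ?p = "\<Sum>m\<in>M. monom (g m) (e m)"
  have "poly ?p x = 0" if "x \<in> X" for x
    using X(2)[OF that] by (simp add: poly_sum poly_monom)
  then have "?p = 0" using X(1) poly_eq_0_infinite by blast
  then have "coeff ?p k = 0" by simp
  then show ?thesis
    by (simp add: coeff_sum sum.If_cases M Int_def if_distrib cong: if_cong)
qed

text \<open>
  The orders of vanishing at a simple zero \<open>a\<close> of \<open>w\<close> are compared: even on the left, odd on the right.
\<close>

lemma square_eq_simple_times_square:
  fixes P Q w v :: "'a::field poly"
  assumes w: "w = [:-a, 1:] * v" "poly v a \<noteq> 0" and eq: "P\<^sup>2 = w * Q\<^sup>2"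
  shows "P = 0 \<and> Q = 0"
proof (rule ccontr)
  assume ne: "\<not> (P = 0 \<and> Q = 0)"
  have v0: "v \<noteq> 0" and lin: "Polynomial.order a [:-a, 1:] = 1" and ordv: "Polynomial.order a v = 0"
    using w(2) order_power_n_n[of a 1] by (auto simp: order_root)
  have w0: "w \<noteq> 0" unfolding w(1) mult_eq_0_iff using v0 by simp
  then have PQ: "P \<noteq> 0" "Q \<noteq> 0" using eq ne by auto
  have "Polynomial.order a (P * P) = Polynomial.order a (w * (Q * Q))"
    using eq by (simp add: power2_eq_square)
  moreover have "Polynomial.order a (P * P) = 2 * Polynomial.order a P"
    using PQ by (simp add: order_mult)
  moreover have "Polynomial.order a w = 1"
    using order_mult[OF w0[unfolded w(1)], of a] lin ordv unfolding w(1) by linarith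
  then have "Polynomial.order a (w * (Q * Q)) = 1 + 2 * Polynomial.order a Q"
    using PQ w0 by (simp add: order_mult)
  ultimately show False by presburger
qed

text \<open>
  If \<open>c\<^sup>4 = w\<close> satisfies a cubic equation over the polynomials, eliminating \<open>c\<close> and then \<open>c\<^sup>2\<close> gives the
  two equations below; they force all coefficients to be divisible by \<open>p\<close>, so descent applies.
\<close>

lemma descent_quartic:
  fixes r0 r1 r2 r3 w v p :: "'a::field_char_0 poly"
  assumes pe: "prime_elem p" and w: "w = p * v" "\<not> p dvd v"
    and P: "r0\<^sup>2 + w * (r2\<^sup>2 - 2 * r1 * r3) = 0" and Q: "2 * r0 * r2 - r1\<^sup>2 - w * r3\<^sup>2 = 0"
  shows "r0 = 0 \<and> r1 = 0 \<and> r2 = 0 \<and> r3 = 0"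
  using P Q
proof (induction "degree r0 + degree r1 + degree r2 + degree r3" arbitrary: r0 r1 r2 r3 rule: less_induct)
  case less
  have p0: "p \<noteq> 0" using pe by auto
  have degp: "degree p > 0"
    using pe p0 by (metis gr0I is_unit_iff_degree prime_elem_not_unit)
  have dvd_pow: "p dvd x\<^sup>2 \<Longrightarrow> p dvd x" for x using pe by (rule prime_elem_dvd_power)
  \<comment> \<open>Divisibility by \<open>p\<close> propagates in the order r0, r1, r2, r3, the two
    equations being used alternately; for r2 and r3 the factor \<open>v\<close>, not divisible by
    the prime \<open>p\<close>, is stripped off.\<close>
  have P: "r0\<^sup>2 = p * (v * (2 * r1 * r3 - r2\<^sup>2))"
    using less.prems(1) w by (simp add: algebra_simps add_eq_0_iff)
  then obtain s0 where s0: "r0 = p * s0" using dvd_pow[of r0] by (metis dvdE dvd_triv_left)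
  have "r1\<^sup>2 = p * (2 * s0 * r2 - v * r3\<^sup>2)"
    using less.prems(2) w s0 by (simp add: algebra_simps)
  then obtain s1 where s1: "r1 = p * s1" using dvd_pow[of r1] by (metis dvdE dvd_triv_left)
  have "p * (p * s0\<^sup>2) = p * (v * (2 * r1 * r3 - r2\<^sup>2))"
    using P s0 by (simp add: power2_eq_square algebra_simps)
  then have "p * s0\<^sup>2 = v * (2 * r1 * r3 - r2\<^sup>2)" using p0 by (simp only: mult_cancel_left) simp
  then have "v * r2\<^sup>2 = p * (v * (2 * s1 * r3) - s0\<^sup>2)" using s1 by (simp add: algebra_simps)
  then have "p dvd r2\<^sup>2" using pe w(2) by (metis dvd_triv_left prime_elem_dvd_mult_iff)
  then obtain s2 where s2: "r2 = p * s2" using dvd_pow[of r2] by (metis dvdE)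
  have "p * (v * r3\<^sup>2) = p * (p * (2 * s0 * s2 - s1\<^sup>2))"
    using less.prems(2) w s0 s1 s2 by (simp add: algebra_simps power2_eq_square)
  then have "v * r3\<^sup>2 = p * (2 * s0 * s2 - s1\<^sup>2)" using p0 by simp
  then have "p dvd r3\<^sup>2" using pe w(2) by (metis dvd_triv_left prime_elem_dvd_mult_iff)
  then obtain s3 where s3: "r3 = p * s3" using dvd_pow[of r3] by (metis dvdE)
  have "p\<^sup>2 * (s0\<^sup>2 + w * (s2\<^sup>2 - 2 * s1 * s3)) = 0"
    using less.prems(1) unfolding s0 s1 s2 s3 by (simp add: algebra_simps power2_eq_square)
  then have P': "s0\<^sup>2 + w * (s2\<^sup>2 - 2 * s1 * s3) = 0" using p0 by simp
  have "p\<^sup>2 * (2 * s0 * s2 - s1\<^sup>2 - w * s3\<^sup>2) = 0"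
    using less.prems(2) unfolding s0 s1 s2 s3 by (simp add: algebra_simps power2_eq_square)
  then have Q': "2 * s0 * s2 - s1\<^sup>2 - w * s3\<^sup>2 = 0" using p0 by simp
  show ?case
  \<comment> \<open>Division of all four by the nonconstant \<open>p\<close> keeps both equations
    and lowers the total degree unless everything is zero.\<close>
  proof (rule ccontr)
    assume ne: "\<not> ?thesis"
    have deg: "degree (p * s) = degree p + degree s" if "s \<noteq> 0" for s
      using that p0 by (simp add: degree_mult_eq)
    have "degree s \<le> degree (p * s)" for s using deg[of s] by (cases "s = 0") auto
    moreover have "degree s < degree (p * s)" if "s \<noteq> 0" for s using deg[of s] degp that by auto
    ultimately have "degree s0 + degree s1 + degree s2 + degree s3 < degree r0 + degree r1 + degree r2 + degree r3"
      using ne unfolding s0 s1 s2 s3 by (metis (no_types, opaque_lifting) add_le_less_mono add_less_le_mono add_mono mult_zero_right)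
    from less.hyps[OF this P' Q'] show False using ne unfolding s0 s1 s2 s3 by simp
  qed
qed

text \<open>Squaring r0 + r2 c^2 = -c (r1 + r3 c^2) and using c^4 = w gives P = -c^2 Q. Squaring
  again removes c and leaves P^2 = w Q^2 at infinitely many b. The simple zero of w at 1 forces P =
  Q = 0, and these are the equations for the descent.\<close>

lemma fermat_independent:
  fixes r0 r1 r2 r3 :: "complex poly"
  assumes Z: "infinite (fst ` Z)"
    and curve: "\<And>b c. (b, c) \<in> Z \<Longrightarrow> c ^ 4 = 1 - b ^ 4"
    and rel: "\<And>b c. (b, c) \<in> Z \<Longrightarrow> poly r0 b + poly r1 b * c + poly r2 b * c\<^sup>2 + poly r3 b * c ^ 3 = 0"
  shows "r0 = 0 \<and> r1 = 0 \<and> r2 = 0 \<and> r3 = 0"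
proof -
  define w :: "complex poly" where "w = 1 - monom 1 4"
  define P where "P = r0\<^sup>2 + w * (r2\<^sup>2 - 2 * r1 * r3)"
  define Q where "Q = 2 * r0 * r2 - r1\<^sup>2 - w * r3\<^sup>2"
  have "poly (P\<^sup>2 - w * Q\<^sup>2) b = 0" if "b \<in> fst ` Z" for b
  proof -
    from that obtain c where c: "(b, c) \<in> Z" by force
    have w: "poly w b = c ^ 4" using curve[OF c] by (simp add: w_def poly_monom)
    let ?r0 = "poly r0 b" and ?r1 = "poly r1 b" and ?r2 = "poly r2 b" and ?r3 = "poly r3 b"
    have "(?r0 + ?r2 * c\<^sup>2) = - (c * (?r1 + ?r3 * c\<^sup>2))"
      using rel[OF c] by (simp add: algebra_simps power2_eq_square power3_eq_cube eq_neg_iff_add_eq_0)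
    then have "(?r0 + ?r2 * c\<^sup>2)\<^sup>2 = (c * (?r1 + ?r3 * c\<^sup>2))\<^sup>2" by simp
    then have "poly P b = - (c\<^sup>2 * poly Q b)"
      by (simp add: P_def Q_def w algebra_simps power2_eq_square eval_nat_numeral add_eq_0_iff)
    then show ?thesis by (simp add: w power2_eq_square eval_nat_numeral)
  qed
  then have eq: "P\<^sup>2 = w * Q\<^sup>2" using poly_eq_0_infinite[OF Z] by fastforce
  \<comment> \<open>The factorization 1 - x^4 = (x - 1) v exhibits the simple zero at 1, as v(1) =
    -4.\<close>
  define p v :: "complex poly" where "p = [:-1, 1:]" and "v = - [:1, 1, 1, 1:]"
  have "w = p * v" by (simp add: w_def p_def v_def numeral_eq_Suc monom_Suc monom_0 one_pCons)
  moreover from this have "P = 0 \<and> Q = 0"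
    using eq by (intro square_eq_simple_times_square[of w 1 v]) (simp_all add: p_def v_def)
  moreover have "\<not> p dvd v"
    by (simp add: p_def v_def dvd_iff_poly_eq_0)
  moreover have "prime_elem p"
    by (simp add: p_def prime_elem_def flip: poly_eq_0_iff_dvd)
  ultimately show ?thesis
    using descent_quartic[of p w v r0 r2 r1 r3] unfolding P_def Q_def by blast
qed

text \<open>The polynomials \<open>(1 - x\<^sup>4)\<^sup>i x\<^sup>k\<close> with \<open>k < 4\<close> have distinct degrees \<open>4i + k\<close>.\<close>

lemma fermat_monomials_independent:
  fixes f :: "'b \<Rightarrow> complex" and i k l :: "'b \<Rightarrow> nat"
  assumes M: "finite M" and Z: "infinite (fst ` Z)"
    and curve: "\<And>b c. (b, c) \<in> Z \<Longrightarrow> c ^ 4 = 1 - b ^ 4"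
    and small: "\<And>m. m \<in> M \<Longrightarrow> k m < 4 \<and> l m < 4"
    and inj: "inj_on (\<lambda>m. (i m, k m, l m)) M"
    and rel: "\<And>b c. (b, c) \<in> Z \<Longrightarrow> (\<Sum>m\<in>M. f m * (1 - b ^ 4) ^ i m * b ^ k m * c ^ l m) = 0"
    and m: "m \<in> M"
  shows "f m = 0"
proof -
  define P where "P = (\<lambda>m. (1 - monom 1 4 :: complex poly) ^ i m * monom 1 (k m))"
  \<comment> \<open>\<open>r j\<close> is the coefficient of c^j in the given relation, a polynomial
    in b.\<close>
  define r where "r = (\<lambda>j. \<Sum>m\<in>{m\<in>M. l m = j}. smult (f m) (P m))"
  have P0: "P m \<noteq> 0" and degP: "degree (P m) = 4 * i m + k m" for m
  proof -
    have "degree (1 - monom 1 4 :: complex poly) = 4"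
      by (subst diff_conv_add_uminus, subst degree_add_eq_right) (simp_all add: degree_monom_eq)
    moreover from this have "(1 - monom 1 4 :: complex poly) \<noteq> 0" by auto
    ultimately show "P m \<noteq> 0" "degree (P m) = 4 * i m + k m"
      by (simp_all add: P_def degree_mult_eq degree_power_eq degree_monom_eq)
  qed
  have "poly (r 0) b + poly (r 1) b * c + poly (r 2) b * c\<^sup>2 + poly (r 3) b * c ^ 3 = 0"
    if bc: "(b, c) \<in> Z" for b c
  proof -
    have "(\<Sum>j<4. poly (r j) b * c ^ j)
        = (\<Sum>j<4. \<Sum>m\<in>{m\<in>M. l m = j}. f m * (1 - b ^ 4) ^ i m * b ^ k m * c ^ l m)"
      by (auto simp: r_def P_def poly_sum poly_monom sum_distrib_right intro!: sum.cong)
    also have "\<dots> = (\<Sum>m\<in>M. f m * (1 - b ^ 4) ^ i m * b ^ k m * c ^ l m)"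
      by (rule sum.group) (use M small in auto)
    finally show ?thesis using rel[OF bc] by (simp add: eval_nat_numeral)
  qed
  from fermat_independent[OF Z curve this] have "r 0 = 0" "r 1 = 0" "r 2 = 0" "r 3 = 0" by auto
  moreover have "l m \<in> {0, 1, 2, 3}" using small[OF m] by auto
  ultimately have "r (l m) = 0" by auto
  then show ?thesis
    unfolding r_def
  proof (rule sum_distinct_degrees[rotated 3])
    show "inj_on (\<lambda>n. degree (P n)) {n\<in>M. l n = l m}"
    proof (rule inj_onI)
      fix x y assume xy: "x \<in> {n\<in>M. l n = l m}" "y \<in> {n\<in>M. l n = l m}" "degree (P x) = degree (P y)"
      then have "4 * i x + k x = 4 * i y + k y" "k x < 4" "k y < 4"
        using small[of x] small[of y] by (auto simp: degP)
      then have "i x = i y" "k x = k y" by presburger+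
      then show "x = y" using xy inj by (auto simp: inj_on_def)
    qed
  qed (use M m P0 in auto)
qed


section \<open>The Gauss--Manin connection matrix\<close>

abbreviation row4 :: "'a \<Rightarrow> 'a \<Rightarrow> 'a \<Rightarrow> 'a \<Rightarrow> 'a::zero^4" where
  "row4 a b c d \<equiv> vector [a, b, c, d]"

lemma axis_row4:
  "axis 1 1 = row4 1 0 0 (0::complex)" "axis 2 1 = row4 0 1 0 (0::complex)"
  "axis 3 1 = row4 0 0 1 (0::complex)" "axis 4 1 = row4 0 0 0 (1::complex)"
  by (auto simp: vec_eq_4 vector_4 axis_def)

text \<open>The covariant derivative at \<open>z\<close> sees only the section near
  \<open>z\<close>, so an expression for \<open>f\<close> on the open set \<open>V\<close> is
  enough.\<close>

lemma nab_row4: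
  assumes V: "open V" "z \<in> V" and f: "\<And>w. w \<in> V \<Longrightarrow> f w = row4 (f1 w) (f2 w) (f3 w) (f4 w)"
    and d: "holo_deriv f1 z (theta j z) d1" "holo_deriv f2 z (theta j z) d2"
      "holo_deriv f3 z (theta j z) d3" "holo_deriv f4 z (theta j z) d4"
  shows "nab A j f z = row4 d1 d2 d3 d4
    + f1 z *s A z (theta j z) $ 1 + f2 z *s A z (theta j z) $ 2
    + f3 z *s A z (theta j z) $ 3 + f4 z *s A z (theta j z) $ 4"
proof -
  have "holo_deriv (\<lambda>w. f w $ 1) z (theta j z) d1" "holo_deriv (\<lambda>w. f w $ 2) z (theta j z) d2"
    "holo_deriv (\<lambda>w. f w $ 3) z (theta j z) d3" "holo_deriv (\<lambda>w. f w $ 4) z (theta j z) d4"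
    using d by (auto intro: holo_deriv_cong[OF _ V] simp: f vector_4)
  then have "holo_deriv (\<lambda>w. f w $ i) z (theta j z) (row4 d1 d2 d3 d4 $ i)" for i
    using exhaust_4[of i] by (auto simp: vector_4)
  from frechet_derivative_vec_nth[OF this] show ?thesis
    by (simp add: nab_def cov_deriv_def vec_eq_4 vector_4 vector_matrix_mult_def sum_4 f[OF V(2)] algebra_simps)
qed

lemma theta_simps [simp]:
  "theta 1 z $ 1 = z $ 1" "theta 1 z $ 2 = 0" "theta 2 z $ 1 = 0" "theta 2 z $ 2 = z $ 2"
  by (simp_all add: theta_def axis_def)

lemma holo_deriv_Yinv:
  "holo_deriv Yinv z v (- 8 * (1 - 4 * z$1) * v$1 - 128 * z$1 * z$2 * v$1 - 64 * (z$1)\<^sup>2 * v$2)"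
  unfolding Yinv_def
  by (rule holo_deriv_eqI, (rule holo_deriv_intros)+) (simp add: algebra_simps power2_eq_square)

lemma regular_locusD:
  assumes "z \<in> regular_locus"
  shows "z$1 \<noteq> 0" "z$2 \<noteq> 0" "1 - 4 * z$2 \<noteq> 0" "Yinv z \<noteq> 0"
  using assms by (auto simp: regular_locus_def)

text \<open>Frame members have constant coefficients, so their covariant derivatives are rows of the
  connection matrix. The frame conditions give row 1 and \<open>P $ 3\<close>, \<open>PF1\<close>
  gives \<open>P $ 2\<close>, equality of the mixed derivatives of \<open>Omega\<close> gives
  \<open>Q $ 3\<close>, and \<open>PF2\<close> gives \<open>Q $ 2\<close> after division by 1 - 4
  z2.\<close>

lemma gauss_manin_rows:
  assumes V: "open V" "V \<subseteq> regular_locus" and A: "gauss_manin V A" and z: "z \<in> V"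
  defines "P \<equiv> A z (theta 1 z)" and "Q \<equiv> A z (theta 2 z)"
  shows "P $ 1 = row4 0 0 1 0" "Q $ 1 = row4 0 (-1/2) (1/2) 0"
    "P $ 3 = row4 0 0 0 (1 / Yinv z)"
    "P $ 2 = row4 0 0 (2 * z$1) (4 * z$1 / Yinv z)"
    "Q $ 3 = row4 0 0 (- z$1) ((1 - 4 * z$1) / (2 * Yinv z))"
    "Q $ 2 = row4 0 (2 * z$2 / (1 - 4 * z$2)) (- z$1 * (1 + 4 * z$2) / (1 - 4 * z$2))
       ((1 - 4 * z$1 - 16 * z$1 * z$2) / (2 * Yinv z * (1 - 4 * z$2)))"
proof -
  have gm1: "nab12 A Omega w = axis 2 1" "nab A 1 Omega w = axis 3 1"
    "Yinv w *s nab A 1 (nab A 1 Omega) w = axis 4 1" "PF1 A Omega w = 0" "PF2 A Omega w = 0"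
    if "w \<in> V" for w
    using A that unfolding gauss_manin_def by blast+
  have "nab A 1 (nab A 2 Omega) z = nab A 2 (nab A 1 Omega) z"
  proof -
    have "\<forall>i. holo_on (\<lambda>z. Omega z $ i) V"
      unfolding Omega_def holo_on_iff_holo_deriv[where v = 0] by (blast intro: holo_deriv_const)
    then show ?thesis using A z unfolding gauss_manin_def by blast
  qed
  note D = regular_locusD[of z]
  have nz: "z$1 \<noteq> 0" "z$2 \<noteq> 0" "1 - 4 * z$2 \<noteq> 0" "Yinv z \<noteq> 0"
    using D V z by auto
  have O1: "nab A 1 Omega w = row4 0 0 1 0" if "w \<in> V" for w
    using gm1(2)[OF that] by (simp add: axis_row4)
  have O12: "nab12 A Omega w = row4 0 1 0 0" if "w \<in> V" for w
    using gm1(1)[OF that] by (simp add: axis_row4)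
  have O2: "nab A 2 Omega w = row4 0 (-1/2) (1/2) 0" if "w \<in> V" for w
  proof -
    have "nab A 2 Omega w = (1/2) *s (nab A 1 Omega w - nab12 A Omega w)"
      by (simp add: nab12_def vec_eq_iff)
    then show ?thesis by (simp add: O1 O12 that vec_eq_4 vector_4)
  qed
  note const = nab_row4[OF V(1) z _ holo_deriv_const holo_deriv_const holo_deriv_const holo_deriv_const]
  have OO: "Omega w = row4 1 0 0 0" for w by (simp add: Omega_def axis_row4)
  show P1: "P $ 1 = row4 0 0 1 0"
    using const[OF OO, where A = A and j = 1] O1[OF z]
    by (simp add: P_def vec_eq_4 vector_4)
  show Q1: "Q $ 1 = row4 0 (-1/2) (1/2) 0"
    using const[OF OO, where A = A and j = 2] O2[OF z]
    by (simp add: Q_def vec_eq_4 vector_4)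
  have N11: "nab A 1 (nab A 1 Omega) z = P $ 3"
    using const[OF O1, where A = A and j = 1] by (simp add: P_def vec_eq_4 vector_4)
  then show P3: "P $ 3 = row4 0 0 0 (1 / Yinv z)"
    using gm1(3)[OF z] nz by (simp add: axis_row4 vec_eq_4 vector_4 field_simps)
  have N112: "nab A 1 (nab12 A Omega) z = P $ 2" "nab A 2 (nab12 A Omega) z = Q $ 2"
    using const[OF O12, where A = A and j = 1] const[OF O12, where A = A and j = 2]
    by (simp_all add: P_def Q_def vec_eq_4 vector_4)
  then show P2: "P $ 2 = row4 0 0 (2 * z$1) (4 * z$1 / Yinv z)"
    using gm1(4)[OF z] N11 O1[OF z] P3 unfolding PF1_def
    by (simp add: vec_eq_4 vector_4 field_simps)
  have N12: "nab A 1 (nab A 2 Omega) z = (-1/2) *s P $ 2 + (1/2) *s P $ 3"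
    "nab A 2 (nab A 2 Omega) z = (-1/2) *s Q $ 2 + (1/2) *s Q $ 3"
    using const[OF O2, where A = A and j = 1] const[OF O2, where A = A and j = 2]
    by (simp_all add: P_def Q_def vec_eq_4 vector_4)
  have N21: "nab A 2 (nab A 1 Omega) z = Q $ 3"
    using const[OF O1, where A = A and j = 2] by (simp add: Q_def vec_eq_4 vector_4)
  show Q3: "Q $ 3 = row4 0 0 (- z$1) ((1 - 4 * z$1) / (2 * Yinv z))"
    using \<open>nab A 1 (nab A 2 Omega) z = nab A 2 (nab A 1 Omega) z\<close> nz
    unfolding N12 N21 P2 P3 by (simp add: vec_eq_4 vector_4 field_simps)
  have "nab12 A (nab12 A Omega) z = P $ 2 - 2 *s Q $ 2"
    using N112 unfolding nab12_def[of A "nab12 A Omega"] by simp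
  then have vec0: "(-1/2) *s Q $ 2 + (1/2) *s Q $ 3 - z$2 *s (P $ 2 - 2 *s Q $ 2 - row4 0 1 0 0) = 0"
    using gm1(5)[OF z] N12 O12[OF z] unfolding PF2_def by simp
  have 0: "(-1/2) * Q $ 2 $ c + (1/2) * Q $ 3 $ c - z$2 * (P $ 2 $ c - 2 * Q $ 2 $ c - row4 0 1 0 0 $ c) = 0" for c
  proof -
    have "((-1/2) *s Q $ 2 + (1/2) *s Q $ 3 - z$2 *s (P $ 2 - 2 *s Q $ 2 - row4 0 1 0 0)) $ c = 0 $ c"
      using vec0 by (rule arg_cong)
    then show ?thesis
      by (simp only: vector_minus_component vector_add_component vector_smult_component zero_index)
  qed
  have eq: "(1 - 4 * z$2) * Q $ 2 $ c = Q $ 3 $ c - 2 * z$2 * (P $ 2 $ c - row4 0 1 0 0 $ c)" for c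
  proof -
    have "(1 - 4 * z$2) * Q $ 2 $ c - (Q $ 3 $ c - 2 * z$2 * (P $ 2 $ c - row4 0 1 0 0 $ c))
      = -2 * ((-1/2) * Q $ 2 $ c + (1/2) * Q $ 3 $ c - z$2 * (P $ 2 $ c - 2 * Q $ 2 $ c - row4 0 1 0 0 $ c))"
      by (simp add: algebra_simps)
    then show ?thesis unfolding 0 by simp
  qed
  have Q2: "Q $ 2 $ c = (Q $ 3 $ c - 2 * z$2 * (P $ 2 $ c - row4 0 1 0 0 $ c)) / (1 - 4 * z$2)" for c
    using eq[of c] nz(3) by (simp add: nonzero_eq_divide_eq mult.commute)
  have "(1 - 4 * z$1) / (2 * Yinv z) - 2 * z$2 * (4 * z$1 / Yinv z)
      = (1 - 4 * z$1 - 16 * z$1 * z$2) / (2 * Yinv z)"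
    using nz(4) by (simp add: field_simps)
  then show "Q $ 2 = row4 0 (2 * z$2 / (1 - 4 * z$2)) (- z$1 * (1 + 4 * z$2) / (1 - 4 * z$2))
       ((1 - 4 * z$1 - 16 * z$1 * z$2) / (2 * Yinv z * (1 - 4 * z$2)))"
    unfolding vec_eq_4 Q2 Q3 P2 vector_4 by (simp add: algebra_simps)
qed

text \<open>One column of the flatness conditions is a linear system for the two unknown entries X,
  Y of row 4. Eliminating Y leaves X with coefficient d / (2 d (1 - 4 b)): the numerator is again
  the discriminant d, which cancels.\<close>

lemma connection_solve:
  fixes a b d X Y :: complex
  assumes d: "d = (1 - 4 * a)\<^sup>2 - 64 * a\<^sup>2 * b" "d \<noteq> 0" "1 - 4 * b \<noteq> 0"
    and I: "k + (1 - 4 * a) / (2 * d) * X = l + 1 / d * Y"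
    and II: "m + (1 - 4 * a - 16 * a * b) / (2 * d * (1 - 4 * b)) * X = n + 4 * a / d * Y"
  shows "X = 2 * (1 - 4 * b) * (n - m + 4 * a * (k - l))"
    and "Y = d * (k - l) + (1 - 4 * a) / 2 * X"
proof -
  have "1 / d * Y = (k - l) + (1 - 4 * a) / (2 * d) * X"
    using I by (simp add: algebra_simps)
  then have "Y = d * ((k - l) + (1 - 4 * a) / (2 * d) * X)"
    using d(2) by (simp add: divide_eq_eq mult.commute)
  also have "\<dots> = d * (k - l) + (1 - 4 * a) / 2 * X"
    using d(2) by (simp add: distrib_left)
  finally show Y: "Y = d * (k - l) + (1 - 4 * a) / 2 * X" .
  let ?K = "(1 - 4 * a - 16 * a * b) / (2 * d * (1 - 4 * b))"
  have "4 * a / d * Y = 4 * a * (k - l) + 2 * a * (1 - 4 * a) / d * X"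
    unfolding Y using d(2) by (simp add: field_simps)
  then have "(?K - 2 * a * (1 - 4 * a) / d) * X = n - m + 4 * a * (k - l)"
  proof -
    have "(K - G) * X = n - m + u" if "m + K * X = n + (u + G * X)" for K G u
      using that by (simp add: algebra_simps)
    then show ?thesis using II \<open>4 * a / d * Y = _\<close> by simp
  qed
  moreover have "?K - 2 * a * (1 - 4 * a) / d = d / (2 * d * (1 - 4 * b))"
  proof -
    have "?K - 2 * a * (1 - 4 * a) / d
        = (1 - 4 * a - 16 * a * b - 4 * a * (1 - 4 * a) * (1 - 4 * b)) / (2 * d * (1 - 4 * b))"
      using d(2,3) by (simp add: divide_simps)
    also have "1 - 4 * a - 16 * a * b - 4 * a * (1 - 4 * a) * (1 - 4 * b) = d"
      unfolding d(1) by (simp add: algebra_simps power2_eq_square)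
    finally show ?thesis .
  qed
  ultimately have "X / (2 * (1 - 4 * b)) = n - m + 4 * a * (k - l)"
    using d(2) by simp
  then show "X = 2 * (1 - 4 * b) * (n - m + 4 * a * (k - l))"
    using d(3) by (simp add: field_simps)
qed

text \<open>The discriminant and 1 - 4 z2 are kept as atoms d and M while denominators are cleared;
  inserting their values afterwards makes the numerator vanish.\<close>

lemma connection_44_aux:
  fixes a b c d e u v x M :: complex
  assumes "d \<noteq> 0" "M \<noteq> 0"
  shows "2 * M * (- 4 * a * x / d\<^sup>2 + 2 * a * (e / (2 * d))
      - (v / (2 * d\<^sup>2 * M) + 2 * b / M * (4 * a / d) + - a * c / M * (1 / d))
      + 4 * a * (u / (2 * d\<^sup>2) + - a * (1 / d) - (- x / d\<^sup>2)))
    = (2 * a * e * d * M - v - 16 * a * b * d + 2 * a * c * d + 4 * a * M * u - 8 * a\<^sup>2 * d * M) / d\<^sup>2"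
  using assms by (simp add: field_simps power2_eq_square)

text \<open>Row 4 comes from integrability: commuting the two covariant derivatives on the second
  and third frame members gives, in each column, two linear equations for the missing entries,
  solved by \<open>connection_solve\<close>.\<close>

lemma gauss_manin_row4:
  assumes V: "open V" "V \<subseteq> regular_locus" and A: "gauss_manin V A" and z: "z \<in> V"
  shows "A z (theta 1 z) $ 4 = row4 0 0 (2 * z$1 * (1 - 6 * z$1 * (1 - 4 * z$2))) 0" (is "?P $ 4 = _")
    and "A z (theta 2 z) $ 4 = row4 0 0 ((z$1)\<^sup>2 * (24 * z$2 + 8 * z$1 - 32 * z$1 * z$2 - 2)) (z$1)" (is "?Q $ 4 = _")
proof -
  let ?a = "z$1" and ?b = "z$2" and ?d = "Yinv z"
  define d1 d2 where "d1 = - 8 * ?a * (1 - 4 * ?a) - 128 * ?a\<^sup>2 * ?b" and "d2 = - 64 * ?a\<^sup>2 * ?b"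
  have nz: "?d \<noteq> 0" "1 - 4 * ?b \<noteq> 0" using regular_locusD[of z] V z by auto
  have D: "holo_deriv Yinv z (theta 1 z) d1" "holo_deriv Yinv z (theta 2 z) d2"
    using holo_deriv_Yinv[of z "theta 1 z"] holo_deriv_Yinv[of z "theta 2 z"]
    by (simp_all add: d1_def d2_def algebra_simps power2_eq_square)
  note rows = gauss_manin_rows[OF V A]
  have flat: "nab A 1 (nab A 2 (\<lambda>_. e)) z = nab A 2 (nab A 1 (\<lambda>_. e)) z" for e
  proof -
    have "\<forall>i. holo_on (\<lambda>z. e $ i) V"
      unfolding holo_on_iff_holo_deriv[where v = 0] by (blast intro: holo_deriv_const)
    moreover have "\<forall>f. (\<forall>i. holo_on (\<lambda>z. f z $ i) V) \<longrightarrow>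
        (\<forall>z\<in>V. nab A 1 (nab A 2 f) z = nab A 2 (nab A 1 f) z)"
      using A unfolding gauss_manin_def by blast
    ultimately show ?thesis using z by (elim allE[of _ "\<lambda>_. e"]) simp
  qed
  have const: "nab A j (\<lambda>_. row4 0 1 0 0) w = A w (theta j w) $ 2"
      "nab A j (\<lambda>_. row4 0 0 1 0) w = A w (theta j w) $ 3" if "w \<in> V" for j w
    using nab_row4[OF V(1) that refl holo_deriv_const holo_deriv_const holo_deriv_const holo_deriv_const, of A j 0 1 0 0]
      nab_row4[OF V(1) that refl holo_deriv_const holo_deriv_const holo_deriv_const holo_deriv_const, of A j 0 0 1 0]
    by (simp_all add: vec_eq_4 vector_4)
  \<comment> \<open>These are the derivatives of the entries of rows 2 and 3 that enter the mixed
    second derivatives.\<close>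
  have a2: "holo_deriv (\<lambda>w. 2 * w$1) z (theta 2 z) 0" and a1: "holo_deriv (\<lambda>w. - w$1) z (theta 1 z) (- ?a)"
    by (rule holo_deriv_eqI, (rule holo_deriv_intros)+, simp)+
  have d34: "holo_deriv (\<lambda>w. (1 - 4 * w$1) / (2 * Yinv w)) z (theta 1 z)
      ((- 4 * ?a * ?d - (1 - 4 * ?a) * d1) / (2 * ?d\<^sup>2))"
    by (rule holo_deriv_eqI, (rule holo_deriv_intros D)+)
      (use nz in \<open>auto simp: divide_simps power2_eq_square\<close>, (auto simp: algebra_simps power2_eq_square)?)
  have e34: "holo_deriv (\<lambda>w. 1 / Yinv w) z (theta 2 z) (- d2 / ?d\<^sup>2)"
    by (rule holo_deriv_eqI, (rule holo_deriv_intros D)+) (use nz in simp_all)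
  have d22: "holo_deriv (\<lambda>w. 2 * w$2 / (1 - 4 * w$2)) z (theta 1 z) 0"
    by (rule holo_deriv_eqI, (rule holo_deriv_intros)+) (use nz in simp_all)
  have d23: "holo_deriv (\<lambda>w. - w$1 * (1 + 4 * w$2) / (1 - 4 * w$2)) z (theta 1 z) (- ?a * (1 + 4 * ?b) / (1 - 4 * ?b))"
    by (rule holo_deriv_eqI, (rule holo_deriv_intros)+) (use nz in \<open>simp_all add: power2_eq_square\<close>)
  have d24: "holo_deriv (\<lambda>w. (1 - 4 * w$1 - 16 * w$1 * w$2) / (2 * Yinv w * (1 - 4 * w$2))) z (theta 1 z)
      (((- 4 * ?a - 16 * ?a * ?b) * ?d - (1 - 4 * ?a - 16 * ?a * ?b) * d1) / (2 * ?d\<^sup>2 * (1 - 4 * ?b)))"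
    by (rule holo_deriv_eqI, (rule holo_deriv_intros D)+)
      (use nz in \<open>auto simp: divide_simps power2_eq_square\<close>, (auto simp: algebra_simps power2_eq_square)?)
  have e24: "holo_deriv (\<lambda>w. 4 * w$1 / Yinv w) z (theta 2 z) (- 4 * ?a * d2 / ?d\<^sup>2)"
    by (rule holo_deriv_eqI, (rule holo_deriv_intros D)+) (use nz in simp_all)
  note c0 = holo_deriv_const
  \<comment> \<open>Column \<open>c\<close> of flatness on the third frame member; \<open>II\<close>
    is the same on the second.\<close>
  have I: "(row4 0 0 (- ?a) ((- 4 * ?a * ?d - (1 - 4 * ?a) * d1) / (2 * ?d\<^sup>2)) + (- ?a) *s ?P $ 3) $ c
      + (1 - 4 * ?a) / (2 * ?d) * ?P $ 4 $ c = row4 0 0 0 (- d2 / ?d\<^sup>2) $ c + 1 / ?d * ?Q $ 4 $ c" for c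
    using arg_cong[OF flat[of "row4 0 0 1 0"], of "\<lambda>x. x $ c"]
      nab_row4[OF V(1) z trans[OF const(2) rows(5)] c0 c0 a1 d34, where A = A]
      nab_row4[OF V(1) z trans[OF const(2) rows(3)] c0 c0 c0 e34, where A = A]
    by (simp add: algebra_simps)
  have II: "(row4 0 0 (- ?a * (1 + 4 * ?b) / (1 - 4 * ?b))
        (((- 4 * ?a - 16 * ?a * ?b) * ?d - (1 - 4 * ?a - 16 * ?a * ?b) * d1) / (2 * ?d\<^sup>2 * (1 - 4 * ?b)))
        + (2 * ?b / (1 - 4 * ?b)) *s ?P $ 2 + (- ?a * (1 + 4 * ?b) / (1 - 4 * ?b)) *s ?P $ 3) $ c
      + (1 - 4 * ?a - 16 * ?a * ?b) / (2 * ?d * (1 - 4 * ?b)) * ?P $ 4 $ c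
      = (row4 0 0 0 (- 4 * ?a * d2 / ?d\<^sup>2) + (2 * ?a) *s ?Q $ 3) $ c + 4 * ?a / ?d * ?Q $ 4 $ c" for c
    using arg_cong[OF flat[of "row4 0 1 0 0"], of "\<lambda>x. x $ c"]
      nab_row4[OF V(1) z trans[OF const(1) rows(6)] c0 d22 d23 d24, where A = A]
      nab_row4[OF V(1) z trans[OF const(1) rows(4)] c0 c0 a2 e24, where A = A]
    by (simp add: algebra_simps)
  have d: "?d = (1 - 4 * ?a)\<^sup>2 - 64 * ?a\<^sup>2 * ?b" by (simp add: Yinv_def)
  note solve = connection_solve[OF d nz I II]
  note rz = rows[OF z]
  have X12: "?P $ 4 $ 1 = 0" "?P $ 4 $ 2 = 0"
    using solve(1)[of 1] solve(1)[of 2] by (simp_all add: rz vector_4)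
  have X3: "?P $ 4 $ 3 = 2 * ?a * (1 - 6 * ?a * (1 - 4 * ?b))"
    unfolding solve(1)[of 3] using nz(2)
    by (simp add: rz vector_4 divide_simps) (simp add: algebra_simps)
  have X4: "?P $ 4 $ 4 = 0"
  proof -
    define M where "M = 1 - 4 * ?b"
    have M: "M \<noteq> 0" using nz(2) by (simp add: M_def)
    let ?N = "- 4 * ?a * d2 / ?d\<^sup>2 + 2 * ?a * ((1 - 4 * ?a) / (2 * ?d))
      - (((- 4 * ?a - 16 * ?a * ?b) * ?d - (1 - 4 * ?a - 16 * ?a * ?b) * d1) / (2 * ?d\<^sup>2 * M)
         + 2 * ?b / M * (4 * ?a / ?d) + - ?a * (1 + 4 * ?b) / M * (1 / ?d))
      + 4 * ?a * ((- 4 * ?a * ?d - (1 - 4 * ?a) * d1) / (2 * ?d\<^sup>2) + - ?a * (1 / ?d) - (- d2 / ?d\<^sup>2))"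
    let ?u = "- 4 * ?a * ?d - (1 - 4 * ?a) * d1" and ?v = "(- 4 * ?a - 16 * ?a * ?b) * ?d - (1 - 4 * ?a - 16 * ?a * ?b) * d1"
    have "?P $ 4 $ 4 = 2 * M * ?N"
      unfolding solve(1)[of 4] by (simp add: rz vector_4 M_def)
    also have "\<dots> = (2 * ?a * (1 - 4 * ?a) * ?d * M - ?v - 16 * ?a * ?b * ?d + 2 * ?a * (1 + 4 * ?b) * ?d
        + 4 * ?a * M * ?u - 8 * ?a\<^sup>2 * ?d * M) / ?d\<^sup>2"
      by (rule connection_44_aux) (use nz M in auto)
    also have "2 * ?a * (1 - 4 * ?a) * ?d * M - ?v - 16 * ?a * ?b * ?d + 2 * ?a * (1 + 4 * ?b) * ?d
        + 4 * ?a * M * ?u - 8 * ?a\<^sup>2 * ?d * M = 0"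
      by (simp add: d1_def d M_def algebra_simps power2_eq_square)
    finally show ?thesis by simp
  qed
  show "?P $ 4 = row4 0 0 (2 * ?a * (1 - 6 * ?a * (1 - 4 * ?b))) 0"
    using X12 X3 X4 by (simp add: vec_eq_4 vector_4)
  have Y12: "?Q $ 4 $ 1 = 0" "?Q $ 4 $ 2 = 0"
    using solve(2)[of 1] solve(2)[of 2] X12 by (simp_all add: rz vector_4)
  have Y3: "?Q $ 4 $ 3 = ?a\<^sup>2 * (24 * ?b + 8 * ?a - 32 * ?a * ?b - 2)"
    unfolding solve(2)[of 3] X3
    by (simp add: rz vector_4 d) (simp add: algebra_simps power2_eq_square)
  have Y4: "?Q $ 4 $ 4 = ?a"
    unfolding solve(2)[of 4] X4 using nz(1)
    by (simp add: rz vector_4 divide_simps) (simp add: algebra_simps power2_eq_square d d1_def d2_def)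
  show "?Q $ 4 = row4 0 0 (?a\<^sup>2 * (24 * ?b + 8 * ?a - 32 * ?a * ?b - 2)) ?a"
    using Y12 Y3 Y4 by (simp add: vec_eq_4 vector_4)
qed


section \<open>Modular vector fields\<close>

lemma zpart_nth: "zpart t $ i = t $ Inl i" and spart_nth: "spart t $ j = t $ Inr j"
  by (simp_all add: zpart_def spart_def)

lemma bounded_linear_zpart: "bounded_linear zpart" and bounded_linear_spart: "bounded_linear spart"
proof -
  have "norm (zpart t) \<le> norm t * (\<Sum>i\<in>(UNIV::2 set). 1)" for t
  proof -
    have "norm (zpart t) \<le> (\<Sum>i\<in>UNIV. norm (zpart t $ i))" by (simp add: norm_vec_def L2_set_le_sum)
    also have "\<dots> \<le> (\<Sum>i\<in>(UNIV::2 set). norm t)"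
      by (intro sum_mono) (simp add: zpart_nth Finite_Cartesian_Product.norm_nth_le)
    finally show ?thesis by (simp add: mult.commute)
  qed
  then show "bounded_linear zpart"
    by (intro bounded_linear_intro[where K = "\<Sum>i\<in>(UNIV::2 set). 1"]) (simp_all add: vec_eq_iff zpart_nth)
  have "norm (spart t) \<le> norm t * (\<Sum>i\<in>(UNIV::4 set). 1)" for t
  proof -
    have "norm (spart t) \<le> (\<Sum>i\<in>UNIV. norm (spart t $ i))" by (simp add: norm_vec_def L2_set_le_sum)
    also have "\<dots> \<le> (\<Sum>i\<in>(UNIV::4 set). norm t)"
      by (intro sum_mono) (simp add: spart_nth Finite_Cartesian_Product.norm_nth_le)
    finally show ?thesis by (simp add: mult.commute)
  qed
  then show "bounded_linear spart"
    by (intro bounded_linear_intro[where K = "\<Sum>i\<in>(UNIV::4 set). 1"]) (simp_all add: vec_eq_iff spart_nth)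
qed

lemma open_moduli: "open V \<Longrightarrow> open U \<Longrightarrow> open (moduli V U)"
proof -
  assume "open V" "open U"
  then have "open (zpart -` V \<inter> spart -` U)"
    using bounded_linear_zpart bounded_linear_spart
    by (intro open_Int open_vimage linear_continuous_on)
  moreover have "zpart -` V \<inter> spart -` U = moduli V U" by (auto simp: moduli_def)
  ultimately show ?thesis by simp
qed

lemma holo_deriv_zpart:
  assumes "holo_deriv f (zpart t) (zpart v) d"
  shows "holo_deriv (\<lambda>u. f (zpart u)) t v d"
proof -
  obtain f' where f': "(f has_derivative f') (at (zpart t))" "Vector_Spaces.linear (*s) (*) f'" "f' (zpart v) = d"
    using assms unfolding holo_deriv_def by blast
  have "((\<lambda>u. f (zpart u)) has_derivative (\<lambda>v. f' (zpart v))) (at t)"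
    using has_derivative_compose[OF bounded_linear_imp_has_derivative[OF bounded_linear_zpart] f'(1)] .
  moreover have "zpart (x + y) = zpart x + zpart y" "zpart (c *s x) = c *s zpart x" for x y c
    by (simp_all add: vec_eq_iff zpart_nth)
  ultimately show ?thesis
    using f' unfolding holo_deriv_def linear_complex_iff by (intro exI[of _ "\<lambda>v. f' (zpart v)"]) auto
qed

lemma holo_deriv_spart: "holo_deriv (\<lambda>u. spart u $ i) t v (v $ Inr i)"
  unfolding spart_nth by (rule holo_deriv_nth)

lemma frechet_enh_mat:
  assumes "spart t $ 4 \<noteq> 0"
  shows "frechet_derivative (\<lambda>u. enh_mat (spart u)) (at t) v =
    row4 (row4 0 0 0 0) (row4 0 (v $ Inr 1) (v $ Inr 2) 0)
      (row4 0 0 (- v $ Inr 4 / (spart t $ 4)\<^sup>2) 0) (row4 0 0 (v $ Inr 3) (v $ Inr 4))" (is "_ = ?D")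
proof -
  have "holo_deriv (\<lambda>u. enh_mat (spart u) $ i $ j) t v (?D $ i $ j)" for i j
    using exhaust_4[of i] exhaust_4[of j] assms
    by (elim disjE) (simp_all add: enh_mat_def vector_4 holo_deriv_const holo_deriv_spart
        holo_deriv_inverse[OF holo_deriv_spart, simplified])
  from frechet_derivative_mat_nth[OF this] show ?thesis by (simp add: vec_eq_iff)
qed

text \<open>Multiplication by S on the right removes the inverse from the matrix of the connection
  along R. The entries (3,4), (3,3) and (4,3) are then solved for x1, ds44(R) and ds43(R) in terms
  of x2. Stating rows 3 and 4 with a parameter k treats both modular fields at once.\<close>

lemma modular_field_equations:
  fixes k :: complex
  assumes V: "open V" "V \<subseteq> regular_locus" and A: "gauss_manin V A"
    and t: "zpart t \<in> V" "invertible (enh_mat (spart t))" "spart t $ 4 \<noteq> 0"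
    and gm: "gm_matrix A R t $ 3 = row4 0 0 0 k" "gm_matrix A R t $ 4 = row4 0 0 0 0"
  defines "z1 \<equiv> zpart t $ 1" and "z2 \<equiv> zpart t $ 2" and "s3 \<equiv> spart t $ 3" and "s4 \<equiv> spart t $ 4"
  defines "x1 \<equiv> R t $ Inl 1 / z1" and "x2 \<equiv> R t $ Inl 2 / z2"
  shows "x1 = k * s4\<^sup>2 * Yinv (zpart t) - x2 * (1 - 4 * z1) / 2"
    and "R t $ Inr 4 = - k * s3 * s4\<^sup>2 - x2 * z1 * s4"
    and "R t $ Inr 3 = x2 * z1 * s3 - s4 * (x1 * (2 * z1 * (1 - 6 * z1 * (1 - 4 * z2)))
           + x2 * (z1\<^sup>2 * (24 * z2 + 8 * z1 - 32 * z1 * z2 - 2)))"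
proof -
  let ?z = "zpart t" and ?S = "enh_mat (spart t)" and ?v = "R t"
  let ?M = "A ?z (zpart ?v)" and ?P = "A ?z (theta 1 ?z)" and ?Q = "A ?z (theta 2 ?z)"
  define W where "W = frechet_derivative (\<lambda>u. enh_mat (spart u)) (at t) ?v + ?S ** ?M"
  have nz: "z1 \<noteq> 0" "z2 \<noteq> 0" "Yinv ?z \<noteq> 0" "s4 \<noteq> 0"
    using regular_locusD[of ?z] V t by (auto simp: z1_def z2_def s4_def)
  \<comment> \<open>The numbers x1, x2 are the logarithmic components dz_i(R)/z_i, so linearity
    reduces A to its values on the two logarithmic fields.\<close>
  have zv: "zpart ?v = x1 *s theta 1 ?z + x2 *s theta 2 ?z"
    using nz by (simp add: vec_eq_iff forall_2 zpart_nth x1_def x2_def)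
      (simp add: z1_def z2_def zpart_nth)
  have M: "?M $ i $ j = x1 * ?P $ i $ j + x2 * ?Q $ i $ j" for i j
  proof -
    have "Vector_Spaces.linear (*s) (*) (\<lambda>v. A ?z v $ i $ j)"
      using A t(1) unfolding gauss_manin_def by blast
    then show ?thesis unfolding linear_complex_iff zv by simp
  qed
  have "gm_matrix A R t ** ?S = W ** (matrix_inv ?S ** ?S)"
    unfolding gm_matrix_def W_def by (simp add: matrix_mul_assoc)
  also have "matrix_inv ?S ** ?S = mat 1"
    using someI_ex[OF t(2)[unfolded invertible_def]] unfolding matrix_inv_def by blast
  finally have W: "(gm_matrix A R t ** ?S) $ i $ j = W $ i $ j" for i j by (simp add: matrix_mul_rid)
  note rows = gauss_manin_rows[OF V A t(1)] gauss_manin_row4[OF V A t(1)]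
  have S: "?S $ 3 = row4 0 0 (inverse s4) 0" "?S $ 4 = row4 0 0 s3 s4"
    "?S $ 1 = row4 1 0 0 0" "?S $ 2 = row4 0 (spart t $ 1) (spart t $ 2) 0"
    by (simp_all add: enh_mat_def vector_4 s3_def s4_def)
  have z: "zpart t $ 1 = z1" "zpart t $ 2 = z2" "spart t $ 4 = s4"
    by (simp_all add: z1_def z2_def s4_def)
  have SM: "(?S ** ?M) $ i $ j = (\<Sum>k\<in>UNIV. ?S $ i $ k * ?M $ k $ j)" for i j
    by (simp add: matrix_matrix_mult_def)
  have GS: "(gm_matrix A R t ** ?S) $ i $ j = (\<Sum>k\<in>UNIV. gm_matrix A R t $ i $ k * ?S $ k $ j)" for i j
    by (simp add: matrix_matrix_mult_def)
  note eqs = W[unfolded GS W_def vector_add_component SM sum_4 frechet_enh_mat[OF t(3)]]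
  note unf = gm vector_4 M rows S z mult_zero_left mult_zero_right add_0_left add_0_right mult_1_left
  have "k * s4 = inverse s4 * (x1 * (1 / Yinv ?z) + x2 * ((1 - 4 * z1) / (2 * Yinv ?z)))"
    by (rule eqs[of 3 4, unfolded unf])
  also have "\<dots> = (x1 + x2 * (1 - 4 * z1) / 2) / (s4 * Yinv ?z)"
  proof -
    have "inverse s * (x * (1 / y) + w * (e / (2 * y))) = (x + w * e / 2) / (s * y)"
      if "s \<noteq> 0" "y \<noteq> 0" for s x y w e :: complex
      using that by (simp add: field_simps)
    then show ?thesis using nz by simp
  qed
  finally have "k * s4 * (s4 * Yinv ?z) = x1 + x2 * (1 - 4 * z1) / 2"
    using nz by (metis mult_eq_0_iff nonzero_eq_divide_eq)
  then show x1: "x1 = k * s4\<^sup>2 * Yinv ?z - x2 * (1 - 4 * z1) / 2"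
    by (simp add: power2_eq_square eq_diff_eq mult_ac)
  have "k * s3 = - (?v $ Inr 4) / s4\<^sup>2 + inverse s4 * (x2 * - z1)"
    by (rule eqs[of 3 3, unfolded unf])
  then have "k * s3 * s4\<^sup>2 = - (?v $ Inr 4) - x2 * z1 * s4"
  proof -
    have "(- v / s\<^sup>2 + inverse s * (x * - y)) * s\<^sup>2 = - v - x * y * s" if "s \<noteq> 0" for v s x y :: complex
      using that by (simp add: field_simps power2_eq_square)
    then show ?thesis using nz \<open>k * s3 = _\<close> by metis
  qed
  then show "?v $ Inr 4 = - k * s3 * s4\<^sup>2 - x2 * z1 * s4"
    by simp
  have "0 = ?v $ Inr 3 + (s3 * (x2 * - z1) + s4 * (x1 * (2 * z1 * (1 - 6 * z1 * (1 - 4 * z2)))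
           + x2 * (z1\<^sup>2 * (24 * z2 + 8 * z1 - 32 * z1 * z2 - 2))))" (is "0 = _ + (_ + ?y)")
    by (rule eqs[of 4 3, unfolded unf])
  moreover have "v = x * y * s - u" if "0 = v + (s * (x * - y) + u)" for v s x y u :: complex
    using that by (simp add: algebra_simps eq_neg_iff_add_eq_0)
  ultimately have "?v $ Inr 3 = x2 * z1 * s3 - ?y" by blast
  then show "?v $ Inr 3 = x2 * z1 * s3 - s4 * (x1 * (2 * z1 * (1 - 6 * z1 * (1 - 4 * z2)))
           + x2 * (z1\<^sup>2 * (24 * z2 + 8 * z1 - 32 * z1 * z2 - 2)))" .
qed


section \<open>Quasi-modular forms as functions on \<open>T\<close>\<close>

text \<open>\<open>a\<close>, \<open>b\<close>, \<open>c\<close> are branches of the roots,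
  depending on z alone. In (s43, s44) the values are homogeneous of degrees 0, 1, 1, 1, 2, the
  modular weights of \<alpha>, A, B, C, E.\<close>

fun qm_fun :: "(complex^2 \<Rightarrow> complex) \<Rightarrow> (complex^2 \<Rightarrow> complex) \<Rightarrow> (complex^2 \<Rightarrow> complex) \<Rightarrow> point \<Rightarrow> gen \<Rightarrow> complex" where
  "qm_fun a b c t Gen_alpha = 64 * (zpart t $ 1)\<^sup>2 * zpart t $ 2 / (1 - 4 * zpart t $ 1)\<^sup>2"
| "qm_fun a b c t Gen_A = a (zpart t) * spart t $ 4"
| "qm_fun a b c t Gen_B = b (zpart t) * spart t $ 4"
| "qm_fun a b c t Gen_C = c (zpart t) * spart t $ 4"
| "qm_fun a b c t Gen_E = - 8 * spart t $ 3 * spart t $ 4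
     + 2 * (spart t $ 4)\<^sup>2 * (2 * Yinv (zpart t) - (1 - 4 * zpart t $ 1))"

text \<open>Prescribing a^2 and not merely a^4 fixes the sign of A^2, which the derivative of
  \<alpha> involves.\<close>

definition qm_roots :: "(complex^2) set \<Rightarrow> (complex^2 \<Rightarrow> complex) \<Rightarrow> (complex^2 \<Rightarrow> complex) \<Rightarrow> (complex^2 \<Rightarrow> complex) \<Rightarrow> bool" where
  "qm_roots V a b c \<longleftrightarrow> holo_on a V \<and> holo_on b V \<and> holo_on c V \<and>
     (\<forall>z\<in>V. a z ^ 2 = 2 * (1 - 4 * z$1) \<and> b z ^ 4 = 4 * Yinv z \<and> c z ^ 4 = 256 * (z$1)\<^sup>2 * z$2)"

lemma qm_roots_exist:
  assumes V: "open V" "simply_connected V" "V \<subseteq> regular_locus" "\<forall>z\<in>V. 1 - 4 * z$1 \<noteq> 0"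
  shows "\<exists>a b c. qm_roots V a b c"
proof -
  have "holo_on (\<lambda>z. 2 * (1 - 4 * z$1)) V" "holo_on (\<lambda>z. 256 * (z$1)\<^sup>2 * z$2) V" "holo_on (\<lambda>z. 4 * Yinv z) V"
    unfolding holo_on_iff_holo_deriv[where v = 0]
    by (intro ballI exI, (rule holo_deriv_intros holo_deriv_Yinv)+)+
  moreover have "z$1 \<noteq> 0" "z$2 \<noteq> 0" "Yinv z \<noteq> 0" "1 - 4 * z$1 \<noteq> 0" if "z \<in> V" for z
    using V(3,4) regular_locusD[of z] that by auto
  ultimately obtain a b c where
    "holo_on a V" "\<forall>z\<in>V. a z ^ 2 = 2 * (1 - 4 * z$1)"
    "holo_on b V" "\<forall>z\<in>V. b z ^ 4 = 4 * Yinv z"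
    "holo_on c V" "\<forall>z\<in>V. c z ^ 4 = 256 * (z$1)\<^sup>2 * z$2"
    using holo_root_exists[OF V(1,2), of "\<lambda>z. 2 * (1 - 4 * z$1)" 2]
      holo_root_exists[OF V(1,2), of "\<lambda>z. 4 * Yinv z" 4]
      holo_root_exists[OF V(1,2), of "\<lambda>z. 256 * (z$1)\<^sup>2 * z$2" 4]
    by auto
  then show ?thesis unfolding qm_roots_def by blast
qed

text \<open>\<open>Yinv\<close> is (1 - 4 z1)^2 minus the numerator of \<alpha>, so b^4 and c^4 are
  1 - \<alpha> and \<alpha> times a^4.\<close>

lemma qm_fun_relations:
  assumes "qm_roots V a b c" "zpart t \<in> V" "1 - 4 * zpart t $ 1 \<noteq> 0"
  shows "qm_fun a b c t Gen_A ^ 2 = 2 * (1 - 4 * zpart t $ 1) * (spart t $ 4)\<^sup>2"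
    and "1 - qm_fun a b c t Gen_alpha = Yinv (zpart t) / (1 - 4 * zpart t $ 1)\<^sup>2"
    and "qm_fun a b c t Gen_B ^ 4 = (1 - qm_fun a b c t Gen_alpha) * qm_fun a b c t Gen_A ^ 4"
    and "qm_fun a b c t Gen_C ^ 4 = qm_fun a b c t Gen_alpha * qm_fun a b c t Gen_A ^ 4"
proof -
  let ?z = "zpart t" and ?s = "spart t $ 4"
  have r: "a ?z ^ 2 = 2 * (1 - 4 * ?z$1)" "b ?z ^ 4 = 4 * Yinv ?z" "c ?z ^ 4 = 256 * (?z$1)\<^sup>2 * ?z$2"
    using assms unfolding qm_roots_def by auto
  have "a ?z ^ 4 = (a ?z ^ 2) ^ 2" by simp
  then have a4: "a ?z ^ 4 = 4 * (1 - 4 * ?z$1)\<^sup>2" unfolding r by (simp only: power_mult_distrib) simp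
  show "qm_fun a b c t Gen_A ^ 2 = 2 * (1 - 4 * ?z $ 1) * ?s\<^sup>2"
    by (simp add: power_mult_distrib r)
  show al: "1 - qm_fun a b c t Gen_alpha = Yinv ?z / (1 - 4 * ?z $ 1)\<^sup>2"
    using assms(3) by (simp add: Yinv_def diff_divide_distrib)
  show "qm_fun a b c t Gen_B ^ 4 = (1 - qm_fun a b c t Gen_alpha) * qm_fun a b c t Gen_A ^ 4"
    unfolding al using assms(3) by (simp add: power_mult_distrib r a4)
  show "qm_fun a b c t Gen_C ^ 4 = qm_fun a b c t Gen_alpha * qm_fun a b c t Gen_A ^ 4"
    using assms(3) by (simp add: power_mult_distrib r a4)
qed

text \<open>
  With \<open>x\<^sub>i = dz\<^sub>i(R)/z\<^sub>i\<close>, the equations for \<open>R\<close> leave \<open>x\<^sub>2\<close> undetermined; it drops out below.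
\<close>

lemma ramanujan_E_aux:
  fixes z1 z2 s3 s4 x2 k :: complex
  defines "e \<equiv> 1 - 4 * z1"
  defines "D \<equiv> e\<^sup>2 - 64 * z1\<^sup>2 * z2"
  defines "x1 \<equiv> k * s4\<^sup>2 * D - x2 * e / 2"
  defines "v4 \<equiv> - k * s3 * s4\<^sup>2 - x2 * z1 * s4"
  defines "v3 \<equiv> x2 * z1 * s3 - s4 * (x1 * (2 * z1 * (1 - 6 * z1 * (1 - 4 * z2)))
           + x2 * (z1\<^sup>2 * (24 * z2 + 8 * z1 - 32 * z1 * z2 - 2)))"
  defines "dD \<equiv> - 8 * e * (x1 * z1) - 128 * z1 * z2 * (x1 * z1) - 64 * z1\<^sup>2 * (x2 * z2)"
  shows "- 8 * (v3 * s4 + s3 * v4) + 4 * s4 * v4 * (2 * D - e) + 2 * s4\<^sup>2 * (2 * dD + 4 * (x1 * z1))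
    = k * (1/8 * ((- 8 * s3 * s4 + 2 * s4\<^sup>2 * (2 * D - e))\<^sup>2 - 4 * e\<^sup>2 * s4 ^ 4))"
proof -
  \<comment> \<open>w is the common factor of the coefficients of x1 and x2 in the derivative of E.
    They are -8 z1 w and -4 z1 e w, so only x1 + x2 e / 2 survives, which is free of x2; and 4 z1 w
    = e - D turns the result into the square.\<close>
  define w where "w = 1 - 4 * z1 + 16 * z1 * z2"
  have 1: "8 * (2 * z1 * (1 - 6 * z1 * (1 - 4 * z2))) + 4 * (- 8 * e * z1 - 128 * z1\<^sup>2 * z2) + 8 * z1 = - 8 * z1 * w"
    by (simp add: w_def e_def algebra_simps power2_eq_square)
  have 2: "8 * (z1\<^sup>2 * (24 * z2 + 8 * z1 - 32 * z1 * z2 - 2)) - 4 * z1 * (2 * D - e) - 256 * z1\<^sup>2 * z2 = - 4 * z1 * e * w"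
    by (simp add: w_def e_def D_def algebra_simps power2_eq_square)
  have 3: "D = e - 4 * z1 * w"
    by (simp add: w_def e_def D_def algebra_simps power2_eq_square)
  have "- 8 * (v3 * s4 + s3 * v4) + 4 * s4 * v4 * (2 * D - e) + 2 * s4\<^sup>2 * (2 * dD + 4 * (x1 * z1))
    = s4\<^sup>2 * (x1 * (8 * (2 * z1 * (1 - 6 * z1 * (1 - 4 * z2))) + 4 * (- 8 * e * z1 - 128 * z1\<^sup>2 * z2) + 8 * z1)
       + x2 * (8 * (z1\<^sup>2 * (24 * z2 + 8 * z1 - 32 * z1 * z2 - 2)) - 4 * z1 * (2 * D - e) - 256 * z1\<^sup>2 * z2))
      + 8 * k * s3\<^sup>2 * s4\<^sup>2 - 4 * k * s3 * s4 ^ 3 * (2 * D - e)"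
    unfolding v3_def v4_def dD_def by (simp add: algebra_simps power2_eq_square power3_eq_cube)
  also have "\<dots> = s4\<^sup>2 * (- 8 * z1 * w * (x1 + x2 * e / 2)) + 8 * k * s3\<^sup>2 * s4\<^sup>2 - 4 * k * s3 * s4 ^ 3 * (2 * D - e)"
    unfolding 1 2 by (simp add: algebra_simps)
  also have "x1 + x2 * e / 2 = k * s4\<^sup>2 * D" by (simp add: x1_def)
  also have "- 8 * z1 * w * (k * s4\<^sup>2 * D) = 2 * k * s4\<^sup>2 * D * (D - e)" by (simp add: 3)
  finally show ?thesis by (simp add: algebra_simps eval_nat_numeral)
qed

text \<open>\<alpha> and E are differentiated directly. The roots A, B, C have derivatives by
  holomorphy; their values follow by differentiating the formulas for A^2, B^4, C^4 and dividing by
  nonzero factors.\<close>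

lemma qm_fun_derivative:
  fixes k :: complex
  assumes V: "open V" "V \<subseteq> regular_locus" "\<forall>z\<in>V. 1 - 4 * z$1 \<noteq> 0" and A: "gauss_manin V A"
    and U: "open U" "\<forall>s\<in>U. invertible (enh_mat s) \<and> s $ 4 \<noteq> 0"
    and roots: "qm_roots V a b c" and t: "t \<in> moduli V U"
    and gm: "gm_matrix A R t $ 3 = row4 0 0 0 k" "gm_matrix A R t $ 4 = row4 0 0 0 0"
  shows "holo_deriv (\<lambda>u. qm_fun a b c u g) t (R t) (k * ev (qm_fun a b c t) (dtau_gen g))"
proof -
  let ?T = "moduli V U" and ?v = "R t" and ?G = "qm_fun a b c"
  note oT = open_moduli[OF V(1) U(1)]
  have tV: "zpart t \<in> V" and tU: "spart t \<in> U" using t by (auto simp: moduli_def)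
  define z1 z2 s3 s4 where "z1 = zpart t $ 1" and "z2 = zpart t $ 2" and "s3 = spart t $ 3" and "s4 = spart t $ 4"
  note zs = z1_def[symmetric] z2_def[symmetric] s3_def[symmetric] s4_def[symmetric]
  define x1 x2 where "x1 = ?v $ Inl 1 / z1" and "x2 = ?v $ Inl 2 / z2"
  define e D where "e = 1 - 4 * z1" and "D = Yinv (zpart t)"
  have nz: "z1 \<noteq> 0" "z2 \<noteq> 0" "s4 \<noteq> 0" "e \<noteq> 0" "D \<noteq> 0"
    using regular_locusD[of "zpart t"] V(2,3) U(2) tV tU by (auto simp: zs e_def D_def)
  have v12: "zpart ?v $ 1 = x1 * z1" "zpart ?v $ 2 = x2 * z2"
    using nz by (simp_all add: zpart_nth x1_def x2_def)
  have inv: "invertible (enh_mat (spart t))" "spart t $ 4 \<noteq> 0" using U(2) tU by auto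
  note eqs = modular_field_equations[OF V(1,2) A tV inv gm, unfolded zs, folded x1_def x2_def, folded e_def D_def]
  have Deq: "D = e\<^sup>2 - 64 * z1\<^sup>2 * z2" by (simp add: D_def Yinv_def e_def zs)
  define al where "al = ?G t Gen_alpha"
  have aleq: "al = 64 * z1\<^sup>2 * z2 / e\<^sup>2" by (simp add: al_def zs e_def)
  have relT: "?G u Gen_A ^ 2 = 2 * (1 - 4 * zpart u $ 1) * (spart u $ 4)\<^sup>2"
    "?G u Gen_B ^ 4 = (1 - ?G u Gen_alpha) * ?G u Gen_A ^ 4"
    "?G u Gen_C ^ 4 = ?G u Gen_alpha * ?G u Gen_A ^ 4" if "u \<in> ?T" for u
    using qm_fun_relations[OF roots, of u] that V(3) by (auto simp: moduli_def simp del: qm_fun.simps)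
  have A2: "?G t Gen_A ^ 2 = 2 * e * s4\<^sup>2" using relT(1)[OF t] by (simp add: zs e_def del: qm_fun.simps)
  have al1: "1 - al = D / e\<^sup>2"
    unfolding aleq Deq using nz by (simp add: diff_divide_distrib)
  have z1d: "holo_deriv (\<lambda>u. zpart u $ 1) t ?v (x1 * z1)" and z2d: "holo_deriv (\<lambda>u. zpart u $ 2) t ?v (x2 * z2)"
    using holo_deriv_zpart[OF holo_deriv_nth, of _ t ?v] by (simp_all flip: v12)
  note base = z1d z2d holo_deriv_spart holo_deriv_const holo_deriv_add holo_deriv_diff holo_deriv_uminus
    holo_deriv_mult holo_deriv_divide holo_deriv_power
  \<comment> \<open>The derivatives of \<alpha> (by e + 4 z1 = 1) and of A involve x1 and x2 only in
    this combination, so x2 disappears.\<close>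
  have K: "2 * x1 + x2 * e = 2 * (k * s4\<^sup>2 * D)"
    by (subst eqs(1)) (simp add: algebra_simps)
  have dalpha: "holo_deriv (\<lambda>u. ?G u Gen_alpha) t ?v (k * (al * (1 - al) * (2 * e * s4\<^sup>2)))"
  proof (rule holo_deriv_eqI)
    show "holo_deriv (\<lambda>u. ?G u Gen_alpha) t ?v
       (((64 * (2 * z1 * (x1 * z1)) * z2 + 64 * z1\<^sup>2 * (x2 * z2)) * e\<^sup>2
          - 64 * z1\<^sup>2 * z2 * (2 * e * (- 4 * (x1 * z1)))) / (e\<^sup>2)\<^sup>2)"
      unfolding qm_fun.simps
      by (rule holo_deriv_eqI, (rule base)+) (use nz in \<open>simp_all add: zs e_def algebra_simps\<close>)
    have "(64 * (2 * z1 * (x1 * z1)) * z2 + 64 * z1\<^sup>2 * (x2 * z2)) * e\<^sup>2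
          - 64 * z1\<^sup>2 * z2 * (2 * e * (- 4 * (x1 * z1)))
      = 64 * z1\<^sup>2 * z2 * e * (2 * x1 * (e + 4 * z1) + x2 * e)"
      by (simp add: algebra_simps power2_eq_square)
    also have "\<dots> = 64 * z1\<^sup>2 * z2 * e * (2 * (k * s4\<^sup>2 * D))"
      unfolding K[symmetric] by (simp add: e_def)
    finally show "((64 * (2 * z1 * (x1 * z1)) * z2 + 64 * z1\<^sup>2 * (x2 * z2)) * e\<^sup>2
          - 64 * z1\<^sup>2 * z2 * (2 * e * (- 4 * (x1 * z1)))) / (e\<^sup>2)\<^sup>2 = k * (al * (1 - al) * (2 * e * s4\<^sup>2))"
      unfolding al1 unfolding aleq using nz by (simp add: field_simps power2_eq_square)
  qed
  have ex: "\<exists>d. holo_deriv (\<lambda>u. ?G u g) t ?v d" if "g \<in> {Gen_A, Gen_B, Gen_C}" for g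
  proof -
    obtain da db dc where "holo_deriv a (zpart t) (zpart ?v) da"
      "holo_deriv b (zpart t) (zpart ?v) db" "holo_deriv c (zpart t) (zpart ?v) dc"
      using roots tV holo_on_holo_deriv unfolding qm_roots_def by meson
    note this[THEN holo_deriv_zpart, THEN holo_deriv_mult, OF holo_deriv_spart[where i = 4]]
    then show ?thesis using that by auto
  qed
  have dE: "holo_deriv (\<lambda>u. ?G u Gen_E) t ?v (k * (1/8 * (?G t Gen_E ^ 2 - 4 * e\<^sup>2 * s4 ^ 4)))"
  proof (rule holo_deriv_eqI)
    let ?dD = "- 8 * e * (x1 * z1) - 128 * z1 * z2 * (x1 * z1) - 64 * z1\<^sup>2 * (x2 * z2)"
    have Dd: "holo_deriv (\<lambda>u. Yinv (zpart u)) t ?v ?dD"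
      by (rule holo_deriv_eqI[OF holo_deriv_zpart[OF holo_deriv_Yinv]]) (simp add: v12 zs e_def)
    let ?v3 = "?v $ Inr 3" and ?v4 = "?v $ Inr 4"
    show "holo_deriv (\<lambda>u. ?G u Gen_E) t ?v
      (- 8 * (?v3 * s4 + s3 * ?v4) + 4 * s4 * ?v4 * (2 * D - e) + 2 * s4\<^sup>2 * (2 * ?dD + 4 * (x1 * z1)))"
      unfolding qm_fun.simps
      by (rule holo_deriv_eqI, (rule base Dd)+) (simp add: zs e_def D_def[symmetric] algebra_simps)
    show "- 8 * (?v3 * s4 + s3 * ?v4) + 4 * s4 * ?v4 * (2 * D - e) + 2 * s4\<^sup>2 * (2 * ?dD + 4 * (x1 * z1))
       = k * (1/8 * (?G t Gen_E ^ 2 - 4 * e\<^sup>2 * s4 ^ 4))"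
      unfolding eqs(2,3) unfolding eqs(1)
      using ramanujan_E_aux[where ?s4.0 = s4 and ?z1.0 = z1 and ?x2.0 = x2 and ?s3.0 = s3 and k = k and ?z2.0 = z2, folded e_def, folded Deq]
      by (simp only: qm_fun.simps zs e_def[symmetric] D_def[symmetric])
  qed
  have A4: "?G t Gen_A ^ 4 = 4 * e\<^sup>2 * s4 ^ 4"
  proof -
    have "?G t Gen_A ^ 4 = (?G t Gen_A ^ 2) ^ 2" by simp
    then show ?thesis unfolding A2 by (simp add: power_mult_distrib)
  qed
  have ne: "?G t Gen_A \<noteq> 0" "?G t Gen_B \<noteq> 0" "?G t Gen_C \<noteq> 0"
  proof -
    show An: "?G t Gen_A \<noteq> 0" using A2 nz by auto
    have "al \<noteq> 0" "1 - al \<noteq> 0" unfolding al1 using nz by (auto simp: aleq)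
    then show "?G t Gen_B \<noteq> 0" "?G t Gen_C \<noteq> 0"
      using relT(2,3)[OF t] An by (auto simp del: qm_fun.simps simp flip: al_def)
  qed
  have dA: "holo_deriv (\<lambda>u. ?G u Gen_A) t ?v (k * (1/8 * ?G t Gen_A * (?G t Gen_E + (2 * al - 1) * ?G t Gen_A ^ 2)))"
  proof -
    obtain d where d: "holo_deriv (\<lambda>u. ?G u Gen_A) t ?v d" using ex by blast
    have "holo_deriv (\<lambda>u. 2 * (1 - 4 * zpart u $ 1) * (spart u $ 4)\<^sup>2) t ?v
        (- 8 * (x1 * z1) * s4\<^sup>2 + 2 * e * (2 * s4 * ?v $ Inr 4))"
      by (rule holo_deriv_eqI, (rule base)+) (simp add: zs e_def algebra_simps)
    then have "holo_deriv (\<lambda>u. ?G u Gen_A ^ 2) t ?v (- 8 * (x1 * z1) * s4\<^sup>2 + 2 * e * (2 * s4 * ?v $ Inr 4))"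
      by (rule holo_deriv_cong[OF _ oT t]) (simp add: relT del: qm_fun.simps)
    with holo_deriv_power[OF d, of 2] have
      "2 * ?G t Gen_A * d = - 8 * (x1 * z1) * s4\<^sup>2 + 2 * e * (2 * s4 * ?v $ Inr 4)"
      by (auto dest: holo_deriv_unique simp del: qm_fun.simps)
    also have "\<dots> = - 4 * z1 * s4\<^sup>2 * (2 * x1 + x2 * e) - 4 * e * k * s3 * s4 ^ 3"
      unfolding eqs(2) by (simp add: algebra_simps power2_eq_square power3_eq_cube)
    also have "\<dots> = - 8 * k * z1 * s4 ^ 4 * D - 4 * e * k * s3 * s4 ^ 3"
      unfolding K by (simp add: power2_eq_square eval_nat_numeral)
    also have "\<dots> = k * (1/4 * (2 * e * s4\<^sup>2) * ((- 8 * s3 * s4 + 2 * s4\<^sup>2 * (2 * D - e)) + (1 - 2 * (D / e\<^sup>2)) * (2 * e * s4\<^sup>2)))"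
    proof -
      \<comment> \<open>With D / e^2 as an atom q and the rule q e^2 = D, the identity becomes
        polynomial.\<close>
      define q where "q = D / e\<^sup>2"
      have q: "q * e\<^sup>2 = D" using nz by (simp add: q_def)
      have "k * (1/4 * (2 * e * s4\<^sup>2) * (y + (1 - 2 * q) * (2 * e * s4\<^sup>2)))
          = k * (1/4 * (2 * e * s4\<^sup>2) * (y + 2 * e * s4\<^sup>2)) - 2 * k * (q * e\<^sup>2) * s4 ^ 4" for y
        by (simp add: algebra_simps eval_nat_numeral)
      moreover have "- 8 * k * z1 * s4 ^ 4 * D - 4 * e * k * s3 * s4 ^ 3
        = k * (1/4 * (2 * e * s4\<^sup>2) * ((- 8 * s3 * s4 + 2 * s4\<^sup>2 * (2 * D - e)) + 2 * e * s4\<^sup>2)) - 2 * k * D * s4 ^ 4"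
        by (simp add: e_def algebra_simps eval_nat_numeral)
      ultimately show ?thesis unfolding q_def[symmetric] q by simp
    qed
    also have "\<dots> = 2 * ?G t Gen_A * (k * (1/8 * ?G t Gen_A * (?G t Gen_E + (2 * al - 1) * ?G t Gen_A ^ 2)))"
    proof -
      have 1: "2 * al - 1 = 1 - 2 * (D / e\<^sup>2)" unfolding al1[symmetric] by simp
      have 2: "?G t Gen_E = - 8 * s3 * s4 + 2 * s4\<^sup>2 * (2 * D - e)" by (simp add: zs e_def D_def)
      have 3: "2 * X * (k * (1/8 * X * (Y + u * X ^ 2))) = k * (1/4 * (X ^ 2) * (Y + u * X ^ 2))" for X Y u :: complex
        by (simp add: power2_eq_square)
      show ?thesis unfolding 3 unfolding A2 1 2 by (rule refl)
    qed
    finally have "d = k * (1/8 * ?G t Gen_A * (?G t Gen_E + (2 * al - 1) * ?G t Gen_A ^ 2))"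
      using ne(1) by (simp only: mult_cancel_left) auto
    with d show ?thesis by (simp only:)
  qed
  \<comment> \<open>\<open>dtau_rel_aux\<close>, the identity behind the stability of the relation
    ideal, is reused over the complex numbers. As the relations hold there, its right-hand side is
    zero, which matches the derivatives of B^4 and C^4 with the expected ones.\<close>
  have eighth: "8 * (1/8) = (1::complex)" by simp
  have dB: "holo_deriv (\<lambda>u. ?G u Gen_B) t ?v (k * (1/8 * ?G t Gen_B * (?G t Gen_E - ?G t Gen_A ^ 2)))"
  proof -
    obtain d where d: "holo_deriv (\<lambda>u. ?G u Gen_B) t ?v d" using ex by blast
    from holo_deriv_mult[OF holo_deriv_diff[OF holo_deriv_const dalpha] holo_deriv_power[OF dA, of 4]]
    have h: "holo_deriv (\<lambda>u. ?G u Gen_B ^ 4) t ?v ((1 - ?G t Gen_alpha) * (of_nat 4 * ?G t Gen_A ^ (4 - 1) * (k * (1/8 * ?G t Gen_A * (?G t Gen_E + (2 * al - 1) * ?G t Gen_A ^ 2))))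
        + (0 - k * (al * (1 - al) * (2 * e * s4\<^sup>2))) * ?G t Gen_A ^ 4)"
      by (rule holo_deriv_cong[OF _ oT t]) (simp add: relT del: qm_fun.simps)
    have
      "4 * ?G t Gen_B ^ 3 * d = (1 - al) * (4 * ?G t Gen_A ^ 3 * (k * (1/8 * ?G t Gen_A * (?G t Gen_E + (2 * al - 1) * ?G t Gen_A ^ 2))))
        - k * (al * (1 - al) * ?G t Gen_A ^ 2) * ?G t Gen_A ^ 4"
      using holo_deriv_unique[OF holo_deriv_power[OF d, of 4] h]
      by (simp add: A2 mult_ac del: qm_fun.simps flip: al_def)
    also have "\<dots> = 4 * ?G t Gen_B ^ 3 * (k * (1/8 * ?G t Gen_B * (?G t Gen_E - ?G t Gen_A ^ 2)))"
    proof -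
      have B4: "?G t Gen_B ^ 4 - (1 - al) * ?G t Gen_A ^ 4 = 0"
        using relT(2)[OF t] by (simp add: al_def del: qm_fun.simps)
      have lin: "P - k * Q * W = S" if "S' + Q * W - P' = 0" "P = k * P'" "S = k * S'" for P Q W S P' S' :: complex
      proof -
        have "P' = S' + Q * W" using that(1) by (simp add: algebra_simps)
        then show ?thesis unfolding that(2,3) by (simp add: algebra_simps)
      qed
      show ?thesis
        by (rule lin[OF dtau_rel_aux(1)[OF eighth, of "?G t Gen_B" "?G t Gen_E" "?G t Gen_A" al, unfolded B4 mult_zero_right]])
          (simp_all only: mult_ac)
    qed
    finally have "d = k * (1/8 * ?G t Gen_B * (?G t Gen_E - ?G t Gen_A ^ 2))"
      using ne(2) by (simp only: mult_cancel_left) auto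
    with d show ?thesis by (simp only:)
  qed
  have dC: "holo_deriv (\<lambda>u. ?G u Gen_C) t ?v (k * (1/8 * ?G t Gen_C * (?G t Gen_E + ?G t Gen_A ^ 2)))"
  proof -
    obtain d where d: "holo_deriv (\<lambda>u. ?G u Gen_C) t ?v d" using ex by blast
    from holo_deriv_mult[OF dalpha holo_deriv_power[OF dA, of 4]]
    have h: "holo_deriv (\<lambda>u. ?G u Gen_C ^ 4) t ?v (?G t Gen_alpha * (of_nat 4 * ?G t Gen_A ^ (4 - 1) * (k * (1/8 * ?G t Gen_A * (?G t Gen_E + (2 * al - 1) * ?G t Gen_A ^ 2))))
        + (k * (al * (1 - al) * (2 * e * s4\<^sup>2))) * ?G t Gen_A ^ 4)"
      by (rule holo_deriv_cong[OF _ oT t]) (simp add: relT del: qm_fun.simps)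
    have
      "4 * ?G t Gen_C ^ 3 * d = al * (4 * ?G t Gen_A ^ 3 * (k * (1/8 * ?G t Gen_A * (?G t Gen_E + (2 * al - 1) * ?G t Gen_A ^ 2))))
        + k * (al * (1 - al) * ?G t Gen_A ^ 2) * ?G t Gen_A ^ 4"
      using holo_deriv_unique[OF holo_deriv_power[OF d, of 4] h]
      by (simp add: A2 mult_ac del: qm_fun.simps flip: al_def)
    also have "\<dots> = 4 * ?G t Gen_C ^ 3 * (k * (1/8 * ?G t Gen_C * (?G t Gen_E + ?G t Gen_A ^ 2)))"
    proof -
      have C4: "?G t Gen_C ^ 4 - al * ?G t Gen_A ^ 4 = 0"
        using relT(3)[OF t] by (simp add: al_def del: qm_fun.simps)
      have lin: "P + k * Q * W = S" if "S' - Q * W - P' = 0" "P = k * P'" "S = k * S'" for P Q W S P' S' :: complex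
      proof -
        have "S' = P' + Q * W" using that(1) by (simp add: algebra_simps)
        then show ?thesis unfolding that(2,3) by (simp add: algebra_simps)
      qed
      show ?thesis
        by (rule lin[OF dtau_rel_aux(2)[OF eighth, of "?G t Gen_C" "?G t Gen_E" "?G t Gen_A" al, unfolded C4 mult_zero_right]])
          (simp_all only: mult_ac)
    qed
    finally have "d = k * (1/8 * ?G t Gen_C * (?G t Gen_E + ?G t Gen_A ^ 2))"
      using ne(3) by (simp only: mult_cancel_left) auto
    with d show ?thesis by (simp only:)
  qed
  show ?thesis
    using dalpha dA dB dC dE
    by (cases g) (simp_all add: ev_simps al_def A4[symmetric] A2[symmetric] del: qm_fun.simps)
qed


section \<open>Injectivity\<close>

lemma prod_gen: "(\<Prod>v\<in>UNIV. h v) = h Gen_alpha * h Gen_A * h Gen_B * h Gen_C * h Gen_E" for h :: "gen \<Rightarrow> complex"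
  by (simp add: UNIV_gen mult.assoc)

lemma open_infinite:
  fixes S :: "'a::{perfect_space, t1_space} set"
  shows "open S \<Longrightarrow> x \<in> S \<Longrightarrow> infinite S"
  using islimpt_finite[of S x] islimpt_UNIV[of x] by (metis Int_UNIV_left islimpt_Int_eventually eventually_at_in_open' islimpt_def open_Int)

text \<open>Coordinate slices of V and U are open, hence infinite once nonempty; they supply the
  parameter values needed to separate monomials.\<close>

lemma open_vec_update:
  fixes W :: "('a::topological_space^'n) set"
  assumes "open W"
  shows "open {x. (\<chi> j. if j = i then x else v $ j) \<in> W}"
proof -
  have "continuous_on UNIV (\<lambda>x. if j = i then x else v $ j)" for j :: 'n
    by (cases "j = i") (auto intro: continuous_intros)
  then have "continuous_on UNIV (\<lambda>x. \<chi> j. if j = i then x else v $ j)"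
    by (intro continuous_on_vec_lambda)
  from open_vimage[OF assms this] show ?thesis by (simp add: vimage_def)
qed

definition mk_point :: "complex^2 \<Rightarrow> complex^4 \<Rightarrow> point" where
  "mk_point z s = (\<chi> i. case i of Inl j \<Rightarrow> z $ j | Inr j \<Rightarrow> s $ j)"

lemma mk_point_parts [simp]: "zpart (mk_point z s) = z" "spart (mk_point z s) = s"
  by (simp_all add: mk_point_def zpart_def spart_def vec_eq_iff)

text \<open>Here \<beta> = B/A and \<gamma> = C/A. Infinitely many \<beta> occur because 1 -
  \<beta>^4 = \<alpha> is, at a fixed z1, a nonconstant linear function of z2.\<close>

lemma qm_curve_infinite:
  assumes V: "open V" "V \<noteq> {}" "V \<subseteq> regular_locus" "\<forall>z\<in>V. 1 - 4 * z$1 \<noteq> 0"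
    and roots: "qm_roots V a b c"
  defines "Z \<equiv> (\<lambda>z. (b z / a z, c z / a z)) ` V"
  shows "infinite (fst ` Z)" and "\<And>\<beta> \<gamma>. (\<beta>, \<gamma>) \<in> Z \<Longrightarrow> \<gamma> ^ 4 = 1 - \<beta> ^ 4"
    and "z \<in> V \<Longrightarrow> 1 - (b z / a z) ^ 4 = 64 * (z$1)\<^sup>2 * z$2 / (1 - 4 * z$1)\<^sup>2" and "z \<in> V \<Longrightarrow> a z \<noteq> 0"
proof -
  let ?al = "\<lambda>z. 64 * (z$1)\<^sup>2 * z$2 / (1 - 4 * z$1)\<^sup>2"
  have a0: "a z \<noteq> 0" if "z \<in> V" for z
  proof -
    have "a z ^ 2 \<noteq> 0" using roots V(4) that unfolding qm_roots_def by auto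
    then show ?thesis by auto
  qed
  have bc: "(c z / a z) ^ 4 = ?al z" "1 - (b z / a z) ^ 4 = ?al z" if "z \<in> V" for z
  proof -
    \<comment> \<open>With s44 = 1 the relations on T become relations between the roots
      alone.\<close>
    let ?t = "mk_point z (\<chi> i. 1)"
    from qm_fun_relations(3,4)[OF roots, of ?t] that V(4)
    have "b z ^ 4 = (1 - ?al z) * a z ^ 4" "c z ^ 4 = ?al z * a z ^ 4" by simp_all
    then show "(c z / a z) ^ 4 = ?al z" "1 - (b z / a z) ^ 4 = ?al z"
      using a0[OF that] by (simp_all add: power_divide)
  qed
  show "1 - (b z / a z) ^ 4 = ?al z" "a z \<noteq> 0" if "z \<in> V"
    using bc(2) a0 that by auto
  show "\<gamma> ^ 4 = 1 - \<beta> ^ 4" if "(\<beta>, \<gamma>) \<in> Z" for \<beta> \<gamma>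
    using that bc unfolding Z_def by auto
  obtain z0 where z0: "z0 \<in> V" using V(2) by blast
  let ?u = "\<lambda>w. (\<chi> j. if j = 2 then w else z0 $ j) :: complex^2"
  have "?u (z0 $ 2) = z0" by (simp add: vec_eq_iff)
  then have inf: "infinite {w. ?u w \<in> V}"
    using open_infinite[OF open_vec_update[OF V(1)], of "z0 $ 2" 2 z0] z0 by simp
  have "z0 $ 1 \<noteq> 0" "1 - 4 * z0 $ 1 \<noteq> 0" using z0 V(3,4) regular_locusD by auto
  then have "inj (\<lambda>w. ?al (?u w))" by (intro injI) (simp add: vec_eq_iff)
  then have "infinite ((\<lambda>w. ?al (?u w)) ` {w. ?u w \<in> V})"
    using inf finite_imageD inj_on_subset by blast
  moreover have "(\<lambda>w. ?al (?u w)) ` {w. ?u w \<in> V} \<subseteq> (\<lambda>x. 1 - x ^ 4) ` fst ` Z"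
  proof (rule image_subsetI)
    fix w assume "w \<in> {w. ?u w \<in> V}"
    then have "?u w \<in> V" by simp
    then show "?al (?u w) \<in> (\<lambda>x. 1 - x ^ 4) ` fst ` Z"
      unfolding Z_def image_image fst_conv bc(2)[symmetric, OF \<open>?u w \<in> V\<close>] by (rule imageI)
  qed
  ultimately show "infinite (fst ` Z)" using finite_subset by blast
qed

lemma qm_fun_independent:
  assumes V: "open V" "V \<noteq> {}" "V \<subseteq> regular_locus" "\<forall>z\<in>V. 1 - 4 * z$1 \<noteq> 0"
    and U: "open U" "U \<noteq> {}" "\<forall>s\<in>U. s $ 4 \<noteq> 0"
    and roots: "qm_roots V a b c"
    and red: "\<forall>m\<in>Poly_Mapping.keys n. Poly_Mapping.lookup m Gen_B < 4 \<and> Poly_Mapping.lookup m Gen_C < 4"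
    and ev0: "\<And>t. t \<in> moduli V U \<Longrightarrow> ev (qm_fun a b c t) n = 0"
  shows "n = 0"
proof -
  let ?M = "Poly_Mapping.keys n" and ?f = "Poly_Mapping.lookup n" and ?e = "\<lambda>m v. Poly_Mapping.lookup m v"
  let ?al = "\<lambda>z::complex^2. 64 * (z$1)\<^sup>2 * z$2 / (1 - 4 * z$1)\<^sup>2"
  let ?h = "\<lambda>z m. ?f m * ?al z ^ ?e m Gen_alpha * a z ^ ?e m Gen_A * b z ^ ?e m Gen_B * c z ^ ?e m Gen_C"
  let ?deg = "\<lambda>m. ?e m Gen_A + ?e m Gen_B + ?e m Gen_C"
  obtain s0 where s0: "s0 \<in> U" using U(2) by blast
  let ?s4 = "\<lambda>y. (\<chi> j. if j = 4 then y else s0 $ j) :: complex^4"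
  let ?s = "\<lambda>x y. (\<chi> j. if j = 3 then x else ?s4 y $ j) :: complex^4"
  define Y where "Y = {y. ?s4 y \<in> U}"
  have "?s4 (s0 $ 4) = s0" by (simp add: vec_eq_iff)
  then have Y: "infinite Y"
    using open_infinite[OF open_vec_update[OF U(1)], of "s0 $ 4" 4 s0] s0 by (simp add: Y_def)
  have X: "infinite {x. ?s x y \<in> U}" if "y \<in> Y" for y
  proof -
    have "?s (s0 $ 3) y = ?s4 y" by (simp add: vec_eq_iff)
    then show ?thesis
      using open_infinite[OF open_vec_update[OF U(1)], of "s0 $ 3" 3 "?s4 y"] that by (simp add: Y_def)
  qed
  have y0: "y \<noteq> 0" if "y \<in> Y" for y using U(3) that by (force simp: Y_def)
  \<comment> \<open>With z and y = s44 fixed, E is affine in s43 with slope -8 y. It takes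
    infinitely many values while the other generators stay constant.\<close>
  have step1: "(\<Sum>m\<in>{m\<in>?M. ?e m Gen_E = j}. ?h z m * y ^ ?deg m) = 0" if z: "z \<in> V" and y: "y \<in> Y" for z y j
  proof -
    let ?E = "\<lambda>x. - 8 * x * y + 2 * y\<^sup>2 * (2 * Yinv z - (1 - 4 * z $ 1))"
    have "inj ?E" using y0[OF y] by (intro injI) simp
    then have "infinite (?E ` {x. ?s x y \<in> U})"
      using X[OF y] finite_imageD inj_on_subset by blast
    moreover have "(\<Sum>m\<in>?M. (?h z m * y ^ ?deg m) * r ^ ?e m Gen_E) = 0" if r: "r \<in> ?E ` {x. ?s x y \<in> U}" for r
    proof -
      obtain x where x: "?s x y \<in> U" "r = ?E x" using r by blast
      have "ev (qm_fun a b c (mk_point z (?s x y))) n = 0"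
        using x z by (intro ev0) (simp add: moduli_def)
      then show ?thesis
        unfolding ev_def prod_gen x(2)
        by (simp add: power_mult_distrib power_add mult_ac)
    qed
    ultimately show ?thesis by (rule sum_powers_infinite[OF finite_keys])
  qed
  \<comment> \<open>\<open>?h\<close> does not involve s44, so varying s44 separates the total
    degrees in A, B, C.\<close>
  have step2: "(\<Sum>m\<in>{m\<in>?M. ?e m Gen_E = j \<and> ?deg m = d}. ?h z m) = 0" if z: "z \<in> V" for z j d
    using sum_powers_infinite[of "{m\<in>?M. ?e m Gen_E = j}" Y "?h z" ?deg d, OF _ Y step1[OF z]] by simp
  note curve = qm_curve_infinite[OF V roots]
  have "?f m0 = 0" if m0: "m0 \<in> ?M" for m0
  proof -
    \<comment> \<open>Here the exponent of E and the total degree are fixed, so the exponents of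
      \<alpha>, B, C determine the monomial. Division by a power of a(z) leaves monomials in
      \<alpha>, B/A and C/A.\<close>
    let ?N = "{m\<in>?M. ?e m Gen_E = ?e m0 Gen_E \<and> ?deg m = ?deg m0}"
    show ?thesis
    proof (rule fermat_monomials_independent[OF _ curve(1,2), where M = ?N and i = "\<lambda>m. ?e m Gen_alpha"
          and k = "\<lambda>m. ?e m Gen_B" and l = "\<lambda>m. ?e m Gen_C"])
      show "inj_on (\<lambda>m. (?e m Gen_alpha, ?e m Gen_B, ?e m Gen_C)) ?N"
      proof (rule inj_onI)
        fix x y assume xy: "x \<in> ?N" "y \<in> ?N"
          "(?e x Gen_alpha, ?e x Gen_B, ?e x Gen_C) = (?e y Gen_alpha, ?e y Gen_B, ?e y Gen_C)"
        then have "?e x v = ?e y v" for v by (cases v) auto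
        then show "x = y" by (rule poly_mapping_eqI)
      qed
      fix \<beta> \<gamma> assume "(\<beta>, \<gamma>) \<in> (\<lambda>z. (b z / a z, c z / a z)) ` V"
      then obtain z where z: "z \<in> V" "\<beta> = b z / a z" "\<gamma> = c z / a z" by blast
      have a0: "a z \<noteq> 0" using curve(4) z by blast
      have eq: "?h z m = a z ^ ?deg m0 * (?f m * (1 - \<beta> ^ 4) ^ ?e m Gen_alpha * \<beta> ^ ?e m Gen_B * \<gamma> ^ ?e m Gen_C)"
        if "m \<in> ?N" for m
      proof -
        have "?deg m0 = ?deg m" using that by simp
        then show ?thesis
          unfolding z(2,3) curve(3)[OF z(1)] using a0 by (simp add: power_add power_divide)
      qed
      have "a z ^ ?deg m0 * (\<Sum>m\<in>?N. ?f m * (1 - \<beta> ^ 4) ^ ?e m Gen_alpha * \<beta> ^ ?e m Gen_B * \<gamma> ^ ?e m Gen_C)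
          = (\<Sum>m\<in>?N. ?h z m)"
        unfolding sum_distrib_left by (intro sum.cong refl eq[symmetric])
      also have "\<dots> = 0" by (rule step2[OF z(1)])
      finally have "a z ^ ?deg m0 * (\<Sum>m\<in>?N. ?f m * (1 - \<beta> ^ 4) ^ ?e m Gen_alpha * \<beta> ^ ?e m Gen_B * \<gamma> ^ ?e m Gen_C) = 0" .
      then show "(\<Sum>m\<in>?N. ?f m * (1 - \<beta> ^ 4) ^ ?e m Gen_alpha * \<beta> ^ ?e m Gen_B * \<gamma> ^ ?e m Gen_C) = 0"
        using a0 by simp
    qed (use m0 red in auto)
  qed
  then show ?thesis by (metis in_keys_iff lookup_zero poly_mapping_eqI)
qed

section \<open>The embedding\<close>

text \<open>Both sides obey the sum and product rules, so agreement on the generators propagates to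
  all polynomials.\<close>

lemma holo_deriv_ev:
  assumes "\<And>g. holo_deriv (\<lambda>u. G u g) t v (k * ev (G t) (d g))"
  shows "holo_deriv (\<lambda>u. ev (G u) p) t v (k * ev (G t) (derivation d p))"
proof (induction p rule: pol_induct)
  case (Const c)
  then show ?case by (simp add: ev_Const derivation_Const ev_zero holo_deriv_const)
next
  case (Var g)
  then show ?case using assms by (simp add: ev_Var derivation_Var)
next
  case (add p q)
  from holo_deriv_add[OF this] show ?case
    by (simp add: ev_add derivation_add distrib_left)
next
  case (mult p q)
  from holo_deriv_mult[OF this] show ?case
    by (simp add: ev_add ev_mult derivation_mult algebra_simps)
qed

text \<open>As \<open>inverse 0 = 0\<close>, \<open>enh_mat\<close> is defined even at s44 = 0. The
  parametrization of enhanced bases excludes this value, since the (4,4) entry is s44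
  itself.\<close>

lemma enhanced_enh_mat: "enhanced (enh_mat s) \<Longrightarrow> invertible (enh_mat s) \<and> s $ 4 \<noteq> 0"
proof -
  assume e: "enhanced (enh_mat s)"
  moreover have "enh_mat s $ 1 $ 1 = 1" by (simp add: enh_mat_def vector_4)
  ultimately obtain s' where "s' $ 4 \<noteq> 0" "enh_mat s = enh_mat s'"
    using enhanced_iff_enh_mat by blast
  moreover have "enh_mat x $ 4 $ 4 = x $ 4" for x by (simp add: enh_mat_def vector_4)
  ultimately have "s $ 4 \<noteq> 0" by metis
  then show ?thesis using e by (simp add: enhanced_def)
qed

theorem theorem2:
  fixes V :: "(complex^2) set" and U :: "(complex^4) set"
    and A :: conn_form and R1 R2 :: "point \<Rightarrow> point"
  assumes V: "open V" "V \<noteq> {}" "simply_connected V"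
    and V_regular: "V \<subseteq> regular_locus"
    and V_alpha: "\<forall>z\<in>V. 1 - 4 * z$1 \<noteq> 0"
    and U: "open U" "\<exists>s\<in>U. enh_mat s = mat 1"
    and U_enhanced: "\<forall>s\<in>U. enhanced (enh_mat s)"
    and A: "gauss_manin V A"
    and R1: "modular_field1 (moduli V U) A R1"
    and R2: "modular_field2 (moduli V U) A R2"
  shows "\<exists>\<phi> \<in> ring_hom QM_ring (O_ring (moduli V U)).
    inj_on \<phi> (carrier QM_ring) \<and>
    (\<forall>c. \<phi> (QM_class (Const c)) = (\<lambda>t\<in>moduli V U. c)) \<and>
    (\<forall>x\<in>carrier QM_ring. \<phi> (QM_dtau x) = lie (moduli V U) R1 (\<phi> x)) \<and>
    (\<forall>x\<in>carrier QM_ring. lie (moduli V U) R2 (\<phi> x) \<in> \<phi> ` carrier QM_ring)"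
proof -
  let ?T = "moduli V U"
  obtain a b c where roots: "qm_roots V a b c"
    using qm_roots_exist[OF V(1,3) V_regular V_alpha] by blast
  let ?G = "qm_fun a b c"
  have Uinv: "\<forall>s\<in>U. invertible (enh_mat s) \<and> s $ 4 \<noteq> 0"
    using U_enhanced enhanced_enh_mat by blast
  have oT: "open ?T" using V(1) U(1) by (rule open_moduli)
  have rows1: "gm_matrix A R1 t $ 3 = row4 0 0 0 1" "gm_matrix A R1 t $ 4 = row4 0 0 0 0" if "t \<in> ?T" for t
    using R1 that unfolding modular_field1_def by (auto simp: vector_4)
  have rows2: "gm_matrix A R2 t $ 3 = row4 0 0 0 0" "gm_matrix A R2 t $ 4 = row4 0 0 0 0" if "t \<in> ?T" for t
    using R2 that unfolding modular_field2_def by (auto simp: vector_4)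
  note deriv = qm_fun_derivative[OF V(1) V_regular V_alpha A U(1) Uinv roots]
  define F where "F p = (\<lambda>t\<in>?T. ev (?G t) p)" for p
  have F_deriv: "holo_deriv (F p) t (R t) (k * ev (?G t) (derivation dtau_gen p))"
    if "t \<in> ?T" "gm_matrix A R t $ 3 = row4 0 0 0 k" "gm_matrix A R t $ 4 = row4 0 0 0 0" for p t R k
    by (rule holo_deriv_cong[OF holo_deriv_ev[OF deriv[OF that]] oT that(1)]) (simp add: F_def)
  have lie1: "lie ?T R1 (F p) = F (derivation dtau_gen p)" for p
    unfolding lie_def using frechet_holo_deriv[OF F_deriv[OF _ rows1]] by (auto simp: F_def fun_eq_iff)
  have lie2: "lie ?T R2 (F p) = F 0" for p
    unfolding lie_def using frechet_holo_deriv[OF F_deriv[OF _ rows2]] by (auto simp: F_def ev_zero fun_eq_iff)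
  have F_O: "F p \<in> carrier (O_ring ?T)" for p
    unfolding O_ring_def holo_on_def using F_deriv[OF _ rows1, of _ p]
    by (auto simp: holo_deriv_def F_def)
  have ideal0: "ev (?G t) p = 0" if "p \<in> QM_ideal" "t \<in> ?T" for p t
  proof (rule ev_QM_ideal[OF _ _ that(1)])
    have "zpart t \<in> V" "1 - 4 * zpart t $ 1 \<noteq> 0" using that(2) V_alpha by (auto simp: moduli_def)
    note r = qm_fun_relations(3,4)[OF roots this]
    show "ev (?G t) rel1 = 0" "ev (?G t) rel2 = 0"
      unfolding rel1_def rel2_def ev_simps r by simp_all
  qed
  \<comment> \<open>The kernel of evaluation is exactly the relation ideal: p - q is congruent to a
    reduced \<open>n\<close>, which also evaluates to zero and so vanishes. The equivalence gives
    well-definedness and injectivity of \<phi> together.\<close>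
  have F_eq: "F p = F q \<longleftrightarrow> p - q \<in> QM_ideal" for p q
  proof
    assume "p - q \<in> QM_ideal"
    from ideal0[OF this] show "F p = F q" by (auto simp: F_def ev_diff fun_eq_iff)
  next
    assume F: "F p = F q"
    obtain n where n: "\<forall>k\<in>Poly_Mapping.keys n. Poly_Mapping.lookup k Gen_B < 4 \<and> Poly_Mapping.lookup k Gen_C < 4"
      "(p - q) - n \<in> QM_ideal"
      using reduced_representative by blast
    have "n = 0"
    proof (rule qm_fun_independent[OF V(1,2) V_regular V_alpha U(1) _ _ roots n(1)])
      show "U \<noteq> {}" "\<forall>s\<in>U. s $ 4 \<noteq> 0" using U(2) Uinv by auto
      fix t assume t: "t \<in> ?T"
      then have "ev (?G t) p = ev (?G t) q" using fun_cong[OF F, of t] by (simp add: F_def)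
      then show "ev (?G t) n = 0" using ideal0[OF n(2) t] by (simp add: ev_diff)
    qed
    then show "p - q \<in> QM_ideal" using n(2) by simp
  qed
  \<comment> \<open>A representative is picked by choice; by \<open>F_eq\<close> the value does not
    depend on it.\<close>
  define \<phi> where "\<phi> X = F (SOME p. QM_class p = X)" for X
  have \<phi>: "\<phi> (QM_class p) = F p" for p
  proof -
    have "QM_class (SOME q. QM_class q = QM_class p) = QM_class p" by (rule someI) (rule refl)
    then show ?thesis unfolding \<phi>_def F_eq QM_class_eq_iff .
  qed
  show ?thesis
  proof (intro bexI conjI allI ballI)
    show "\<phi> \<in> ring_hom QM_ring (O_ring ?T)"
    proof (rule ring_hom_memI)
      show "\<phi> \<one>\<^bsub>QM_ring\<^esub> = \<one>\<^bsub>O_ring ?T\<^esub>"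
        unfolding QM_ring_simps \<phi> by (simp add: F_def ev_one O_ring_def cong: restrict_cong)
    qed (auto simp: carrier_QM_ring QM_ring_simps \<phi> F_O, auto simp: F_def O_ring_def ev_add ev_mult fun_eq_iff)
    show "inj_on \<phi> (carrier QM_ring)"
      by (auto simp: inj_on_def carrier_QM_ring \<phi> F_eq QM_class_eq_iff)
    show "\<phi> (QM_class (Const k)) = (\<lambda>t\<in>?T. k)" for k
      by (simp add: \<phi> F_def ev_Const)
    show "\<phi> (QM_dtau x) = lie ?T R1 (\<phi> x)" if "x \<in> carrier QM_ring" for x
      using that by (auto simp: carrier_QM_ring QM_dtau_class \<phi> lie1)
    show "lie ?T R2 (\<phi> x) \<in> \<phi> ` carrier QM_ring" if "x \<in> carrier QM_ring" for x
    proof -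
      have "lie ?T R2 (\<phi> x) = \<phi> (QM_class 0)" using that by (auto simp: carrier_QM_ring \<phi> lie2)
      then show ?thesis by (simp add: carrier_QM_ring)
    qed
  qed
qed

end
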